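(* Let $\beta>0$, let $b\geq 2$ be an integer, and fix $\theta\in[0,2\pi)$. For $N\in\mathbb{N}$ let $(\theta_1,\dots,\theta_N)$ be distributed according to the circular $\beta$-ensemble and let $D_{N,\beta}(\theta)=\prod_{j=1}^N(e^{i\theta}-e^{i\theta_j})$. Write the base-$b$ expansion of $|D_{N,\beta}(\theta)|$ as $$|D_{N,\beta}(\theta)|=\Big(\sum_{k=1}^\infty d_{k,N}(\theta)\,b^{1-k}\Big)b^{M},$$ where $M\in\mathbb{Z}$, $d_{k,N}(\theta)\in\{0,1,\dots,b-1\}$ and $d_{1,N}(\theta)\neq 0$. Then for every integer $\ell\geq 1$, every $k_1\in\{1,\dots,b-1\}$, every $k_2,\dots,k_\ell\in\{0,1,\dots,b-1\}$ and every $\varepsilon>0$, $$\left|\mathbb{P}\big(d_{1,N}(\theta)=k_1,\dots,d_{\ell,N}(\theta)=k_\ell\big)-\log_b\Big(1+\frac{1}{\sum_{j=1}^{\ell}k_j b^{\ell-j}}\Big)\right|=o\big((\log N)^{-3/2+\varepsilon}\big)\quad\text{as }N\to\infty.$$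
   Context: The circular $\beta$-ensemble (C$\beta$E) with $N$ points is the random vector $(\theta_1,\dots,\theta_N)\in[0,2\pi)^N$ whose law has density proportional to $\prod_{1\leq j<k\leq N}|e^{i\theta_j}-e^{i\theta_k}|^\beta$ with respect to Lebesgue measure $d\theta_1\cdots d\theta_N$. The law of $|D_{N,\beta}(\theta)|$ does not depend on $\theta$. *)

theory Defs
  imports "HOL-Probability.Probability" "HOL-Library.Landau_Symbols"
begin

definition cbe_weight :: "nat \<Rightarrow> real \<Rightarrow> (nat \<Rightarrow> real) \<Rightarrow> real" where
  "cbe_weight N \<beta> \<theta>s =
     (\<Prod>j\<in>{..<N}. \<Prod>k\<in>{j<..<N}. cmod (cis (\<theta>s j) - cis (\<theta>s k)) powr \<beta>)"

definition cbe_base :: "nat \<Rightarrow> (nat \<Rightarrow> real) measure" where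
  "cbe_base N = PiM {..<N} (\<lambda>_. restrict_space lborel {0..<2*pi})"

definition cbe_normalisation :: "nat \<Rightarrow> real \<Rightarrow> real" where
  "cbe_normalisation N \<beta> = (\<integral>\<theta>s. cbe_weight N \<beta> \<theta>s \<partial>cbe_base N)"

definition CbetaE :: "nat \<Rightarrow> real \<Rightarrow> (nat \<Rightarrow> real) measure" where
  "CbetaE N \<beta> = density (cbe_base N)
      (\<lambda>\<theta>s. ennreal (cbe_weight N \<beta> \<theta>s / cbe_normalisation N \<beta>))"

definition charpoly :: "nat \<Rightarrow> (nat \<Rightarrow> real) \<Rightarrow> real \<Rightarrow> complex" where
  "charpoly N \<theta>s \<theta> = (\<Prod>j\<in>{..<N}. cis \<theta> - cis (\<theta>s j))"

text \<open>Base-b exponent M and k-th significant digit (k >= 1) of x > 0: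
  x = (sum_k d_k b^(1-k)) b^M with d_1 <> 0, using the standard (greedy,
  not eventually (b-1)) expansion of the mantissa x / b^M in [1,b).\<close>
definition sig_exponent :: "nat \<Rightarrow> real \<Rightarrow> int" where
  "sig_exponent b x = \<lfloor>log (real b) x\<rfloor>"

definition sig_digit :: "nat \<Rightarrow> nat \<Rightarrow> real \<Rightarrow> nat" where
  "sig_digit b k x =
     nat (\<lfloor>(x / real b powr real_of_int (sig_exponent b x)) * real b ^ (k - 1)\<rfloor> mod int b)"

end

theory Submission
  imports Defs "HOL-Real_Asymp.Real_Asymp"
begin

text \<open>
  Write \<open>x\<^sub>j = 1 - cis (\<theta>\<^sub>j - \<theta>)\<close> and let \<open>M(s)\<close> be the expectation of \<open>\<bar>D\<bar>\<^sup>s = \<Prod>\<^sub>j \<bar>x\<^sub>j\<bar>\<^sup>s\<close>.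
  Integrating by parts in one angle and symmetrising (Aomoto's method) gives
  \<open>M(s + 2) = R(s) M(s)\<close> for \<open>Re s \<ge> 0\<close>, where \<open>R(s)\<close> is the product over \<open>j < N\<close> of
  \<open>(1 + s + c\<^sub>j) (2 + s + c\<^sub>j) / (1 + s / 2 + c\<^sub>j)\<^sup>2\<close> with \<open>c\<^sub>j = j \<beta> / 2\<close>.
  As \<open>\<bar>M(2n + it)\<bar> \<le> M(2n)\<close>, iterating the recursion \<open>n\<close> times at \<open>it\<close> and at \<open>0\<close> bounds
  \<open>\<bar>M(it)\<bar>\<close> by \<open>\<Prod>\<^sub>k\<^sub><\<^sub>n \<bar>R(2k) / R(2k + it)\<bar>\<close>, so no evaluation of the Selberg-Morris integral is
  needed. Every factor of this product is at most \<open>1\<close>, and for \<open>n = N\<close> the factors with \<open>k < j\<close>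
  already give a power of \<open>N\<close>, uniformly for \<open>\<bar>t\<bar> \<ge> t\<^sub>0 > 0\<close>. Hence all Fourier coefficients of
  \<open>log\<^sub>b \<bar>D\<bar>\<close> modulo one are \<open>O(N\<^sup>-\<^sup>c)\<close>, and smoothing with the Fejer kernel turns this into a power
  saving in the digit probabilities.
\<close>

subsection \<open>Significant digits\<close>

text \<open>Differentiating the Vandermonde weight produces cotangents of half-differences of
  angles. Symmetrising removes them because the inserted factors are linear in \<open>cis\<close>: a
  difference of two such factors times the cotangent is again linear. For this reason
  \<open>\<bar>x\<bar>\<^sup>2\<close> is inserted as \<open>x\<close> and \<open>cnj x\<close> in
  two separate rounds, whence the two different numerators in \<open>R(s)\<close> over a common
  square. The cotangent has a pole at coinciding angles, which for small \<open>\<beta>\<close> is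
  integrable but unbounded; this is why the integration by parts is done fibre by fibre with
  finitely many exceptional points. On the imaginary axis \<open>\<bar>x\<bar>\<^sup>s\<close> is
  bounded but oscillates at its zero, and it is differentiated only after multiplication by
  \<open>x\<close>. The power of \<open>N\<close> arises from a harmonic sum: for each
  \<open>j\<close>, the \<open>j\<close> factors with \<open>k < j\<close> gain a constant over
  \<open>j\<^sup>2\<close> each in the exponent. The lower bound \<open>t\<^sub>0\<close> is
  available because the frequencies that matter are the nonzero multiples of
  \<open>2 * pi / ln b\<close>. The bound does not improve with the frequency, but the Fejer kernel
  involves only frequencies below its degree, and this degree may itself be a power of
  \<open>N\<close>.\<close>

lemma mod_div_eq_iff_int:
  fixes k c v q :: int
  assumes "0 \<le> k" "k < c"
  shows "v mod c = k \<and> v div c = q \<longleftrightarrow> v = c * q + k"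
proof
  assume "v mod c = k \<and> v div c = q"
  then show "v = c * q + k" using mult_div_mod_eq[of c v] by simp
qed (use assms in simp)

text \<open>Division with remainder by \<open>b\<close> splits the integer part of
  \<open>y * b ^ l\<close> into its last digit and the integer part of
  \<open>y * b ^ (l - 1)\<close>. Induction then reads the digit block off a single integer.\<close>

lemma sig_digits_iff_floor:
  fixes y :: real and kd :: "nat \<Rightarrow> nat"
  assumes b: "b \<ge> 2" and y: "1 \<le> y" "y < real b" and l: "l \<ge> 1"
    and kd: "\<forall>j\<in>{1..l}. kd j < b"
  shows "(\<forall>j\<in>{1..l}. nat (\<lfloor>y * real b ^ (j - 1)\<rfloor> mod int b) = kd j) \<longleftrightarrow>
         \<lfloor>y * real b ^ (l - 1)\<rfloor> = int (\<Sum>j=1..l. kd j * b ^ (l - j))"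
  using l kd
proof (induction l rule: dec_induct)
  case base
  have "0 \<le> \<lfloor>y\<rfloor>" "\<lfloor>y\<rfloor> < int b" using y by (auto simp: floor_less_iff)
  then have "nat \<lfloor>y\<rfloor> = kd 1 \<longleftrightarrow> \<lfloor>y\<rfloor> = int (kd 1)" by linarith
  with \<open>0 \<le> \<lfloor>y\<rfloor>\<close> \<open>\<lfloor>y\<rfloor> < int b\<close> show ?case by simp
next
  case (step l)
  let ?v = "\<lfloor>y * real b ^ l\<rfloor>" and ?\<kappa> = "\<Sum>j=1..l. kd j * b ^ (l - j)"
  have "?v div int b = \<lfloor>y * real b ^ l / real b\<rfloor>"
    using floor_divide_real_eq_div[of "int b" "y * real b ^ l"] by simp
  also have "y * real b ^ l / real b = y * real b ^ (l - 1)"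
    using step b by (cases l) auto
  finally have vdiv: "?v div int b = \<lfloor>y * real b ^ (l - 1)\<rfloor>" .
  have "(\<Sum>j=1..Suc l. kd j * b ^ (Suc l - j)) = (\<Sum>j=1..l. kd j * b ^ (Suc l - j)) + kd (Suc l)"
    by simp
  also have "(\<Sum>j=1..l. kd j * b ^ (Suc l - j)) = b * ?\<kappa>"
    unfolding sum_distrib_left by (intro sum.cong) (auto simp: Suc_diff_le)
  finally have \<kappa>: "(\<Sum>j=1..Suc l. kd j * b ^ (Suc l - j)) = b * ?\<kappa> + kd (Suc l)" .
  have lt: "kd (Suc l) < b" using step by auto
  have split: "{1..Suc l} = insert (Suc l) {1..l}" by auto
  have "(\<forall>j\<in>{1..Suc l}. nat (\<lfloor>y * real b ^ (j - 1)\<rfloor> mod int b) = kd j) \<longleftrightarrow>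
      nat (?v mod int b) = kd (Suc l) \<and> ?v div int b = int ?\<kappa>"
    unfolding split vdiv using step by simp
  also have "\<dots> \<longleftrightarrow> ?v mod int b = int (kd (Suc l)) \<and> ?v div int b = int ?\<kappa>"
  proof -
    have "0 \<le> ?v mod int b" using b by simp
    then have "nat (?v mod int b) = kd (Suc l) \<longleftrightarrow> ?v mod int b = int (kd (Suc l))" by linarith
    then show ?thesis by (simp only:)
  qed
  also have "\<dots> \<longleftrightarrow> ?v = int (b * ?\<kappa> + kd (Suc l))"
    using lt mod_div_eq_iff_int[of "int (kd (Suc l))" "int b" ?v "int ?\<kappa>"] by (simp only: of_nat_add of_nat_mult)
  finally show ?case using \<kappa> by simp
qed

text \<open>These bounds place the interval of logarithms attached to a digit block inside the unit
  interval, so that it can be compared with a fractional part.\<close>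

lemma digit_value_bounds:
  fixes kd :: "nat \<Rightarrow> nat"
  assumes b: "b \<ge> 2" and l: "l \<ge> 1" and kd: "\<forall>j\<in>{1..l}. kd j < b" and kd1: "kd 1 \<ge> 1"
  shows "b ^ (l - 1) \<le> (\<Sum>j=1..l. kd j * b ^ (l - j))"
    and "(\<Sum>j=1..l. kd j * b ^ (l - j)) < b ^ l"
proof -
  have "b ^ (l - 1) \<le> kd 1 * b ^ (l - 1)" using kd1 by simp
  also have "\<dots> \<le> (\<Sum>j=1..l. kd j * b ^ (l - j))"
    using l by (intro member_le_sum) auto
  finally show "b ^ (l - 1) \<le> (\<Sum>j=1..l. kd j * b ^ (l - j))" .
  show "(\<Sum>j=1..l. kd j * b ^ (l - j)) < b ^ l" using l kd
  proof (induction l rule: dec_induct)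
    case base then show ?case by simp
  next
    case (step l)
    have "(\<Sum>j=1..l. kd j * b ^ (Suc l - j)) = b * (\<Sum>j=1..l. kd j * b ^ (l - j))"
      unfolding sum_distrib_left by (intro sum.cong) (auto simp: Suc_diff_le)
    \<comment> \<open>The strict bound for \<open>l\<close> digits, read as
      \<open>... + 1 \<le> b ^ l\<close> and multiplied by \<open>b\<close>, leaves room for one
      further digit below \<open>b\<close>.\<close>
    moreover have "b * (\<Sum>j=1..l. kd j * b ^ (l - j)) + b \<le> b * b ^ l"
      using step by (metis Suc_leI add.commute atLeastAtMost_iff le_SucI mult_Suc_right mult_le_mono2)
    moreover have "kd (Suc l) < b" using step by simp
    ultimately show ?case by simp
  qed
qed

text \<open>The mantissa is \<open>b\<close> raised to the fractional part of the logarithm, so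
  fixing leading digits confines that fractional part to an interval. Benford's law thereby becomes
  equidistribution modulo one.\<close>

lemma sig_digits_iff_frac_log:
  fixes kd :: "nat \<Rightarrow> nat"
  assumes b: "b \<ge> 2" and l: "l \<ge> 1" and kd: "\<forall>j\<in>{1..l}. kd j < b" and kd1: "kd 1 \<ge> 1"
    and x: "x > 0"
  defines "\<kappa> \<equiv> real (\<Sum>j=1..l. kd j * b ^ (l - j))"
  shows "(\<forall>j\<in>{1..l}. sig_digit b j x = kd j) \<longleftrightarrow>
     frac (log (real b) x) \<in> {log (real b) \<kappa> - (real l - 1)..<log (real b) (\<kappa> + 1) - (real l - 1)}"
proof -
  define y where "y = x / real b powr real_of_int (sig_exponent b x)"
  have b1: "real b > 1" using b by simp
  have "x = real b powr log (real b) x" using b1 x by simp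
  then have y: "y = real b powr frac (log (real b) x)"
    unfolding y_def sig_exponent_def frac_def by (metis powr_diff)
  have ypos: "y > 0" using y b1 by simp
  have y1: "1 \<le> y" "y < real b"
    using y b1 frac_lt_1[of "log (real b) x"] frac_ge_0[of "log (real b) x"]
    by (auto simp: ge_one_powr_ge_zero intro: powr_less_mono[of _ 1 "real b", simplified])
  have \<kappa>pos: "\<kappa> > 0" using digit_value_bounds(1)[OF b l kd kd1] b unfolding \<kappa>_def
    by (metis gr0I leD of_nat_0_less_iff not_numeral_le_zero zero_less_power)
  have logy: "log (real b) (y * real b ^ (l - 1)) = frac (log (real b) x) + (real l - 1)"
    using b1 l ypos y by (simp add: log_mult log_nat_power of_nat_diff)
  have "(\<forall>j\<in>{1..l}. sig_digit b j x = kd j) \<longleftrightarrow>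
     \<lfloor>y * real b ^ (l - 1)\<rfloor> = int (\<Sum>j=1..l. kd j * b ^ (l - j))"
    unfolding sig_digit_def y_def[symmetric]
    by (rule sig_digits_iff_floor[OF b y1 l kd])
  also have "\<dots> \<longleftrightarrow> \<kappa> \<le> y * real b ^ (l - 1) \<and> y * real b ^ (l - 1) < \<kappa> + 1"
    unfolding \<kappa>_def floor_eq_iff by simp
  also have "\<dots> \<longleftrightarrow> log (real b) \<kappa> \<le> log (real b) (y * real b ^ (l - 1)) \<and>
      log (real b) (y * real b ^ (l - 1)) < log (real b) (\<kappa> + 1)"
    using b1 ypos \<kappa>pos by simp
  finally show ?thesis unfolding logy by auto
qed

subsection \<open>Equidistribution modulo one from Fourier coefficients\<close>

text \<open>The Fejer kernel of period 1, with Fourier coefficients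
  \<open>1 - \<bar>m\<bar> / K\<close> for \<open>\<bar>m\<bar> < K\<close> when
  \<open>K > 0\<close>. As a squared modulus it is visibly nonnegative, which the one-sided majorant
  argument relies on.\<close>

definition fejer :: "nat \<Rightarrow> real \<Rightarrow> real" where
  "fejer K y = (cmod (\<Sum>m<K. cis (2 * pi * real m * y)))\<^sup>2 / real K"

lemma fejer_nonneg: "fejer K y \<ge> 0"
  by (simp add: fejer_def)

lemma fejer_expand:
  "complex_of_real (fejer K y) =
     (\<Sum>m<K. \<Sum>n<K. cis (2 * pi * (real m - real n) * y)) / of_nat K"
proof -
  let ?S = "\<Sum>m<K. cis (2 * pi * real m * y)"
  have "complex_of_real ((cmod ?S)\<^sup>2) = ?S * cnj ?S"
    by (simp only: complex_norm_square)
  also have "\<dots> = (\<Sum>m<K. \<Sum>n<K. cis (2 * pi * (real m - real n) * y))"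
    by (simp add: cis_cnj sum_product cis_mult algebra_simps)
  finally show ?thesis by (simp add: fejer_def)
qed

lemma continuous_on_fejer [continuous_intros]: "continuous_on A (fejer K)"
proof -
  have "continuous_on A (\<lambda>y. (cmod (\<Sum>m<K. cis (2 * pi * real m * y)))\<^sup>2 / real K)"
    by (cases "K = 0") (auto intro!: continuous_intros)
  then show ?thesis by (simp add: fejer_def[abs_def])
qed

lemma cis_2pi_periodic_int: "cis (2 * pi * (of_int d) * (y - of_int n)) = cis (2 * pi * of_int d * y)"
proof -
  have "cis (2 * pi * (of_int d) * (y - of_int n)) = cis (2 * pi * of_int d * y - 2 * pi * of_int (d * n))"
    by (rule arg_cong[where f = cis]) (simp add: algebra_simps)
  also have "\<dots> = cis (2 * pi * of_int d * y) / cis (2 * pi * of_int (d * n))"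
    by (rule cis_divide[symmetric])
  also have "cis (2 * pi * of_int (d * n)) = 1"
    by (rule cis_multiple_2pi) auto
  finally show ?thesis by simp
qed

lemma fejer_periodic: "fejer K (y - of_int n) = fejer K y"
  using cis_2pi_periodic_int[of "int m" y n for m] by (simp add: fejer_def)

text \<open>The exponential sum is geometric, hence at most \<open>2 / \<bar>1 - z\<bar>\<close>,
  and the denominator equals
  \<open>2 * \<bar>sin (pi * y)\<bar> \<ge> 4 * \<bar>y\<bar>\<close>.\<close>

lemma fejer_tail:
  assumes "0 < \<delta>" "\<delta> \<le> \<bar>y\<bar>" "\<bar>y\<bar> \<le> 1/2"
  shows "fejer K y \<le> 1 / (4 * real K * \<delta>\<^sup>2)"
proof (cases "K = 0")
  case False
  let ?z = "cis (2 * pi * y)"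
  have sin: "2 * \<bar>y\<bar> \<le> \<bar>sin (pi * y)\<bar>"
  proof -
    have "2 * \<bar>y\<bar> \<le> sin (pi * \<bar>y\<bar>)"
    proof -
      \<comment> \<open>Jordan's inequality: by concavity the sine lies above its chord over
        \<open>[0, pi/2]\<close>, and \<open>2 * \<bar>y\<bar>\<close> is the weight in the convex
        combination.\<close>
      have "convex_on {0..pi/2} (\<lambda>x. - sin x)"
        by (rule convex_on_realI[where f' = "\<lambda>x. - cos x"])
           (auto intro!: derivative_eq_intros cos_monotone_0_pi_le)
      from convex_onD[OF this, of "2 * \<bar>y\<bar>" 0 "pi/2"] assms
      show ?thesis by (simp add: mult.commute)
    qed
    also have "sin (pi * \<bar>y\<bar>) \<le> \<bar>sin (pi * y)\<bar>"
      by (cases "y \<ge> 0") (auto simp: abs_if)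
    finally show ?thesis .
  qed
  have "(cmod (1 - ?z))\<^sup>2 = (1 - cos (2 * (pi * y)))\<^sup>2 + (sin (2 * (pi * y)))\<^sup>2"
    by (simp add: cmod_def mult.assoc)
  also have "\<dots> = 4 * (sin (pi * y))\<^sup>2"
    using sin_cos_squared_add[of "pi * y"] unfolding cos_double_sin sin_double by algebra
  finally have "(cmod (1 - ?z))\<^sup>2 = (2 * \<bar>sin (pi * y)\<bar>)\<^sup>2" by simp
  then have nz: "cmod (1 - ?z) = 2 * \<bar>sin (pi * y)\<bar>"
    by (metis abs_ge_zero mult_nonneg_nonneg norm_ge_zero power2_eq_imp_eq zero_le_numeral)
  then have ge: "4 * \<delta> \<le> cmod (1 - ?z)" using sin assms by linarith
  have "(\<Sum>m<K. cis (2 * pi * real m * y)) = (\<Sum>m<K. ?z ^ m)"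
    by (intro sum.cong refl) (simp add: Complex.DeMoivre mult_ac)
  also have "(1 - ?z) * \<dots> = 1 - ?z ^ K" by (rule one_diff_power_eq[symmetric])
  finally have "(1 - ?z) * (\<Sum>m<K. cis (2 * pi * real m * y)) = 1 - ?z ^ K" .
  then have "cmod (1 - ?z) * cmod (\<Sum>m<K. cis (2 * pi * real m * y)) = cmod (1 - ?z ^ K)"
    by (metis norm_mult)
  also have "\<dots> \<le> 2"
    using norm_triangle_ineq4[of 1 "?z ^ K"] by (simp add: norm_power)
  finally have le2: "cmod (1 - ?z) * cmod (\<Sum>m<K. cis (2 * pi * real m * y)) \<le> 2" .
  have "4 * \<delta> * cmod (\<Sum>m<K. cis (2 * pi * real m * y)) \<le> 2"
    using le2 mult_right_mono[OF ge norm_ge_zero] by (meson order_trans)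
  then have "cmod (\<Sum>m<K. cis (2 * pi * real m * y)) \<le> 1 / (2 * \<delta>)"
    using assms by (simp add: field_simps)
  then have "(cmod (\<Sum>m<K. cis (2 * pi * real m * y)))\<^sup>2 \<le> (1 / (2 * \<delta>))\<^sup>2"
    by (intro power_mono) auto
  then show ?thesis using False assms
    by (simp add: fejer_def field_simps power2_eq_square)
qed (simp add: fejer_def)

text \<open>By orthogonality only the \<open>K\<close> diagonal terms of the double sum survive, and
  they are divided by \<open>K\<close>.\<close>

lemma integral_fejer_period:
  assumes "K > 0"
  shows "integral {-1/2..1/2} (fejer K) = 1"
proof -
  have I: "((\<lambda>y. cis (2 * pi * (real m - real n) * y)) has_integral (if m = n then 1 else 0)) {-1/2..1/2}"
    for m n
  proof (cases "m = n")
    case True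
    then show ?thesis using has_integral_const_real[of "1::complex" "-1/2" "1/2"] by simp
  next
    case False
    define d where "d = 2 * pi * (real m - real n)"
    have d: "d \<noteq> 0" using False by (simp add: d_def)
    have "((\<lambda>y. cis (d * y)) has_integral (cis (d * (1/2)) / (\<i> * d) - cis (d * (-1/2)) / (\<i> * d))) {-1/2..1/2}"
    proof (rule fundamental_theorem_of_calculus)
      fix x :: real
      have "((\<lambda>y. cis (d * y) / (\<i> * d)) has_vector_derivative (d *\<^sub>R (\<i> * cis (d * x))) / (\<i> * d)) (at x within {-1/2..1/2})"
        by (intro has_vector_derivative_divide vector_diff_chain_within[unfolded o_def, where g = cis])
           (auto intro!: derivative_eq_intros has_vector_derivative_at_within simp: cis_conv_exp has_vector_derivative_def)
      then show "((\<lambda>y. cis (d * y) / (\<i> * d)) has_vector_derivative cis (d * x)) (at x within {-1/2..1/2})"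
        using d by (simp add: scaleR_conv_of_real)
    qed simp
    moreover have "cis (d * (1/2)) = cis (d * (-1/2))"
    proof -
      have "cis (d * (1/2)) / cis (d * (-1/2)) = cis d" by (simp add: cis_divide)
      also have "\<dots> = 1" unfolding d_def
        by (rule cis_multiple_2pi) (auto intro: Ints_diff)
      finally show ?thesis by simp
    qed
    ultimately show ?thesis using False by (simp add: d_def)
  qed
  have "((\<lambda>y. (\<Sum>m<K. \<Sum>n<K. cis (2 * pi * (real m - real n) * y)) / of_nat K) has_integral
      ((\<Sum>m<K. \<Sum>n<K. if m = n then 1 else 0) / of_nat K)) {-1/2..1/2}"
    by (intro has_integral_divide has_integral_sum I) auto
  then have "((\<lambda>y. complex_of_real (fejer K y)) has_integral 1) {-1/2..1/2}"
    using assms by (simp add: fejer_expand)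
  then have "((\<lambda>y. Re (complex_of_real (fejer K y))) has_integral Re 1) {-1/2..1/2}"
    by (rule has_integral_Re)
  then show ?thesis by (simp add: integral_unique)
qed

lemma fejer_concentration:
  assumes "K > 0" "0 < \<delta>" "\<delta> \<le> 1/2"
  shows "integral {-\<delta>..\<delta>} (fejer K) \<ge> 1 - 1 / (4 * real K * \<delta>\<^sup>2)"
proof -
  let ?\<eta> = "1 / (4 * real K * \<delta>\<^sup>2)"
  have int: "fejer K integrable_on {a..b}" for a b
    by (intro integrable_continuous_real continuous_intros)
  have "integral {-1/2..1/2} (fejer K) = integral {-1/2..-\<delta>} (fejer K) + integral {-\<delta>..1/2} (fejer K)"
    using assms by (intro Henstock_Kurzweil_Integration.integral_combine[symmetric] int) auto
  also have "integral {-\<delta>..1/2} (fejer K) = integral {-\<delta>..\<delta>} (fejer K) + integral {\<delta>..1/2} (fejer K)"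
    using assms by (intro Henstock_Kurzweil_Integration.integral_combine[symmetric] int) auto
  finally have eq: "1 = integral {-1/2..-\<delta>} (fejer K) + (integral {-\<delta>..\<delta>} (fejer K) + integral {\<delta>..1/2} (fejer K))"
    using integral_fejer_period[OF assms(1)] by simp
  have "integral {-1/2..-\<delta>} (fejer K) \<le> integral {-1/2..-\<delta>} (\<lambda>_. ?\<eta>)"
    using assms by (intro integral_le int fejer_tail) auto
  also have "\<dots> = ?\<eta> * (1/2 - \<delta>)" using assms by simp
  finally have 1: "integral {-1/2..-\<delta>} (fejer K) \<le> ?\<eta> * (1/2 - \<delta>)" .
  have "integral {\<delta>..1/2} (fejer K) \<le> integral {\<delta>..1/2} (\<lambda>_. ?\<eta>)"
    using assms by (intro integral_le int fejer_tail) auto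
  also have "\<dots> = ?\<eta> * (1/2 - \<delta>)" using assms by simp
  finally have 2: "integral {\<delta>..1/2} (fejer K) \<le> ?\<eta> * (1/2 - \<delta>)" .
  have "?\<eta> * (1/2 - \<delta>) + ?\<eta> * (1/2 - \<delta>) \<le> ?\<eta> * 1"
    unfolding distrib_left[symmetric] using assms by (intro mult_left_mono) auto
  with eq 1 2 show ?thesis by linarith
qed

text \<open>The kernel is a trigonometric polynomial, so the expectation involves only Fourier
  coefficients of frequency below \<open>K\<close>. The diagonal of the double sum yields the length
  \<open>b - a\<close>; each of the fewer than \<open>K\<^sup>2\<close> other terms costs at most
  \<open>(b - a) * B\<close>, and the division by \<open>K\<close> leaves
  \<open>K * B\<close>.\<close>

lemma (in prob_space) fejer_smoothing:
  assumes X [measurable]: "X \<in> borel_measurable M" and K: "K > 0" and ab: "a \<le> b" and B0: "B \<ge> 0"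
    and B: "\<And>m. 0 < m \<Longrightarrow> m < K \<Longrightarrow> cmod (expectation (\<lambda>\<omega>. cis (2 * pi * real m * X \<omega>))) \<le> B"
  shows "integrable M (\<lambda>\<omega>. integral {a..b} (\<lambda>u. fejer K (u - X \<omega>)))" (is "integrable M ?G")
    and "expectation (\<lambda>\<omega>. integral {a..b} (\<lambda>u. fejer K (u - X \<omega>))) \<le> (b - a) * (1 + real K * B)"
proof -
  define c where "c d = integral {a..b} (\<lambda>u. cis (2 * pi * d * u))" for d :: real
  define e where "e d \<omega> = cis (2 * pi * (- d) * X \<omega>)" for d \<omega>
  have intc: "(\<lambda>u. cis (2 * pi * d * u)) integrable_on {a..b}" for d
    by (intro integrable_continuous_real continuous_intros)
  have G: "complex_of_real (?G \<omega>) =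
      (\<Sum>m<K. \<Sum>n<K. c (real m - real n) * e (real m - real n) \<omega>) / of_nat K" for \<omega>
  proof -
    have "((\<lambda>u. (\<Sum>m<K. \<Sum>n<K. cis (2 * pi * (real m - real n) * u) * e (real m - real n) \<omega>) / of_nat K)
       has_integral (\<Sum>m<K. \<Sum>n<K. c (real m - real n) * e (real m - real n) \<omega>) / of_nat K) {a..b}"
      unfolding c_def
      by (intro has_integral_divide has_integral_sum has_integral_mult_left integrable_integral intc) auto
    also have "(\<lambda>u. (\<Sum>m<K. \<Sum>n<K. cis (2 * pi * (real m - real n) * u) * e (real m - real n) \<omega>) / of_nat K)
        = (\<lambda>u. complex_of_real (fejer K (u - X \<omega>)))"
      unfolding fejer_expand e_def cis_mult by (simp add: algebra_simps)
    finally have 1: "((\<lambda>u. complex_of_real (fejer K (u - X \<omega>))) has_integral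
        (\<Sum>m<K. \<Sum>n<K. c (real m - real n) * e (real m - real n) \<omega>) / of_nat K) {a..b}" .
    have "(\<lambda>u. fejer K (u - X \<omega>)) integrable_on {a..b}"
      by (intro integrable_continuous_real continuous_on_compose2[OF continuous_on_fejer[of UNIV]] continuous_intros) auto
    then have "((\<lambda>u. complex_of_real (fejer K (u - X \<omega>))) has_integral complex_of_real (?G \<omega>)) {a..b}"
      by (intro has_integral_of_real integrable_integral)
    with 1 show ?thesis by (rule has_integral_unique[rotated])
  qed
  have e_meas [measurable]: "e d \<in> borel_measurable M" for d
  proof -
    have "cis \<in> borel_measurable borel"
      by (intro borel_measurable_continuous_onI continuous_intros)
    then show ?thesis unfolding e_def by measurable
  qed
  have inte: "integrable M (e d)" for d
    by (rule integrable_const_bound[where B = 1]) (auto simp: e_def)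
  have intGc: "integrable M (\<lambda>\<omega>. complex_of_real (?G \<omega>))"
    unfolding G by (intro integrable_divide_zero Bochner_Integration.integrable_sum integrable_mult_right inte)
  then show int: "integrable M ?G" by (simp only: complex_of_real_integrable_eq)
  have cle: "cmod (c d) \<le> b - a" for d
  proof -
    have "cmod (c d) \<le> integral {a..b} (\<lambda>_. 1::real)"
      unfolding c_def by (intro integral_norm_bound_integral intc) auto
    then show ?thesis using ab by simp
  qed
  have c0: "c 0 = of_real (b - a)" using ab by (simp add: c_def scaleR_conv_of_real)
  have Ee: "cmod (expectation (e (real m - real n))) \<le> B" if "m < K" "n < K" "m \<noteq> n" for m n
  proof (cases "m < n")
    case True
    have "expectation (e (real m - real n)) = expectation (\<lambda>\<omega>. cis (2 * pi * real (n - m) * X \<omega>))"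
      using True by (intro Bochner_Integration.integral_cong refl) (simp add: e_def of_nat_diff algebra_simps)
    then show ?thesis using B[of "n - m"] True that by simp
  next
    case False
    have "expectation (e (real m - real n)) = expectation (\<lambda>\<omega>. cnj (cis (2 * pi * real (m - n) * X \<omega>)))"
      using False by (intro Bochner_Integration.integral_cong refl) (simp add: e_def cis_cnj of_nat_diff algebra_simps)
    also have "\<dots> = cnj (expectation (\<lambda>\<omega>. cis (2 * pi * real (m - n) * X \<omega>)))"
      by simp
    finally show ?thesis using B[of "m - n"] False that by simp
  qed
  have "complex_of_real (expectation ?G) = expectation (\<lambda>\<omega>. complex_of_real (?G \<omega>))"
    by (rule integral_complex_of_real[symmetric])
  also have "\<dots> = (\<Sum>m<K. \<Sum>n<K. c (real m - real n) * expectation (e (real m - real n))) / of_nat K"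
    unfolding G using inte by (simp add: Bochner_Integration.integral_sum Bochner_Integration.integrable_sum)
  finally have E: "complex_of_real (expectation ?G) = \<dots>" .
  have e0: "expectation (e 0) = 1" using prob_space by (simp add: e_def[abs_def])
  \<comment> \<open>Charging \<open>B\<close> to every pair and correcting the diagonal by
    \<open>1 - B\<close> makes the double sum collapse without splitting the index set.\<close>
  have summand: "cmod (c (real m - real n) * expectation (e (real m - real n)))
      \<le> (b - a) * (B + (if m = n then 1 - B else 0))" if "m < K" "n < K" for m n
    using that Ee[of m n] cle[of "real m - real n"] ab
    by (cases "m = n") (auto simp: e0 norm_mult c0 intro!: mult_mono)
  have "expectation ?G \<le> cmod (complex_of_real (expectation ?G))" by simp
  also have "\<dots> \<le> (\<Sum>m<K. \<Sum>n<K. (b - a) * (B + (if m = n then 1 - B else 0))) / of_nat K"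
    unfolding E norm_divide norm_of_nat
    by (intro divide_right_mono order_trans[OF norm_sum] sum_mono summand) auto
  also have "(\<Sum>m<K. \<Sum>n<K. (b - a) * (B + (if m = n then 1 - B else 0)))
      = (b - a) * (\<Sum>m<K. real K * B + (1 - B))"
    by (simp add: sum_distrib_left[symmetric] sum.distrib)
  also have "\<dots> / of_nat K = (b - a) * (real K * B + (1 - B))"
    using K by simp
  also have "\<dots> \<le> (b - a) * (1 + real K * B)"
    using B0 ab by (intro mult_left_mono) auto
  finally show "expectation ?G \<le> (b - a) * (1 + real K * B)" .
qed

lemma frac_borel_measurable [measurable]: "(\<lambda>x::real. frac x) \<in> borel_measurable borel"
  unfolding frac_def by measurable

text \<open>Integrating the kernel over the interval widened by \<open>\<delta>\<close> on both
  sides gives a smooth majorant: it captures the mass of the kernel within \<open>\<delta>\<close>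
  of its centre when the fractional part lies in the interval, and is nonnegative otherwise.\<close>

lemma (in prob_space) frac_interval_upper:
  assumes X [measurable]: "X \<in> borel_measurable M" and K: "K > 0" and \<alpha>: "\<alpha> \<le> \<alpha>'" "\<alpha>' \<le> \<alpha> + 1"
    and \<delta>: "0 < \<delta>" "\<delta> \<le> 1/2" and B0: "B \<ge> 0"
    and B: "\<And>m. 0 < m \<Longrightarrow> m < K \<Longrightarrow> cmod (expectation (\<lambda>\<omega>. cis (2 * pi * real m * X \<omega>))) \<le> B"
  shows "prob {\<omega>\<in>space M. frac (X \<omega>) \<in> {\<alpha>..<\<alpha>'}} \<le> (\<alpha>' - \<alpha>) + (2 * \<delta> + 2 * real K * B + 1 / (4 * real K * \<delta>\<^sup>2))"
proof -
  let ?A = "{\<omega>\<in>space M. frac (X \<omega>) \<in> {\<alpha>..<\<alpha>'}}" and ?\<eta> = "1 / (4 * real K * \<delta>\<^sup>2)"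
  let ?G = "\<lambda>\<omega>. integral {\<alpha>-\<delta>..\<alpha>'+\<delta>} (\<lambda>u. fejer K (u - X \<omega>))"
  have A: "?A \<in> sets M" by measurable
  have ab: "\<alpha> - \<delta> \<le> \<alpha>' + \<delta>" using \<alpha> \<delta> by simp
  note G = fejer_smoothing[OF X K ab B0 B, simplified]
  have int: "(\<lambda>u. fejer K (u - x)) integrable_on {p..q}" for x p q
    by (intro integrable_continuous_real continuous_on_compose2[OF continuous_on_fejer[of UNIV]] continuous_intros) auto
  have le: "indicator ?A \<omega> * (1 - ?\<eta>) \<le> ?G \<omega>" if "\<omega> \<in> space M" for \<omega>
  proof (cases "\<omega> \<in> ?A")
    case True
    let ?f = "frac (X \<omega>)"
    have "1 - ?\<eta> \<le> integral {-\<delta>..\<delta>} (fejer K)"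
      by (rule fejer_concentration[OF K \<delta>])
    also have "\<dots> = integral {-\<delta>+?f..\<delta>+?f} (\<lambda>u. fejer K (u - ?f))"
    proof -
      have "(fejer K has_integral integral {-\<delta>..\<delta>} (fejer K)) (cbox (-\<delta>) \<delta>)"
        by (simp add: integrable_integral integrable_continuous_real continuous_intros)
      from has_integral_affinity[OF this, of 1 "-?f"] show ?thesis
        by (simp add: integral_unique add.commute image_add_atLeastAtMost cbox_interval)
    qed
    also have "(\<lambda>u. fejer K (u - ?f)) = (\<lambda>u. fejer K (u - X \<omega>))"
    proof
      fix u
      have "u - ?f = (u - X \<omega>) - of_int (- \<lfloor>X \<omega>\<rfloor>)" by (simp add: frac_def)
      then show "fejer K (u - ?f) = fejer K (u - X \<omega>)" by (simp only: fejer_periodic)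
    qed
    also have "integral {-\<delta>+?f..\<delta>+?f} (\<lambda>u. fejer K (u - X \<omega>)) \<le> ?G \<omega>"
      using True by (intro integral_subset_le int) (auto simp: fejer_nonneg)
    finally show ?thesis using True by simp
  next
    case False
    have "0 \<le> ?G \<omega>" by (intro integral_nonneg int) (auto simp: fejer_nonneg)
    with False show ?thesis by simp
  qed
  have "prob ?A * (1 - ?\<eta>) = expectation (\<lambda>\<omega>. indicator ?A \<omega> * (1 - ?\<eta>))"
    using sets.sets_into_space[OF A] by (simp add: Int_absorb2)
  also have "\<dots> \<le> expectation ?G"
    by (intro integral_mono G(1) le) (use A in \<open>auto simp: emeasure_eq_measure\<close>)
  also have "\<dots> \<le> (\<alpha>' + \<delta> - (\<alpha> - \<delta>)) * (1 + real K * B)"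
    using fejer_smoothing(2)[OF X K ab B0 B] by simp
  also have "\<dots> = (\<alpha>' - \<alpha> + 2 * \<delta>) + (\<alpha>' - \<alpha> + 2 * \<delta>) * (real K * B)" by (simp add: algebra_simps)
  \<comment> \<open>The widened interval has length at most
    \<open>1 + 2 * \<delta> \<le> 2\<close>.\<close>
  also have "\<dots> \<le> (\<alpha>' - \<alpha> + 2 * \<delta>) + 2 * (real K * B)"
    using \<alpha> \<delta> B0 by (intro add_left_mono mult_right_mono) auto
  finally have "prob ?A - prob ?A * ?\<eta> \<le> \<alpha>' - \<alpha> + 2 * \<delta> + 2 * (real K * B)" by (simp add: right_diff_distrib)
  \<comment> \<open>Moving this term to the other side, instead of dividing by
    \<open>1 - \<eta>\<close>, keeps the estimate valid even when \<open>\<eta>\<close> exceeds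
    1.\<close>
  moreover have "prob ?A * ?\<eta> \<le> 1 * ?\<eta>" by (intro mult_right_mono) auto
  ultimately show ?thesis by simp
qed

text \<open>No minorant is built: the lower bound follows from the upper bounds for the two
  complementary intervals in \<open>[0, 1)\<close>. Their two errors account for the factor
  2.\<close>

lemma (in prob_space) frac_equidistribution:
  assumes X [measurable]: "X \<in> borel_measurable M" and K: "K > 0"
    and \<alpha>: "0 \<le> \<alpha>" "\<alpha> \<le> \<alpha>'" "\<alpha>' \<le> 1"
    and \<delta>: "0 < \<delta>" "\<delta> \<le> 1/2" and B0: "B \<ge> 0"
    and B: "\<And>m. 0 < m \<Longrightarrow> m < K \<Longrightarrow> cmod (expectation (\<lambda>\<omega>. cis (2 * pi * real m * X \<omega>))) \<le> B"
  shows "\<bar>prob {\<omega>\<in>space M. frac (X \<omega>) \<in> {\<alpha>..<\<alpha>'}} - (\<alpha>' - \<alpha>)\<bar>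
      \<le> 2 * (2 * \<delta> + 2 * real K * B + 1 / (4 * real K * \<delta>\<^sup>2))"
proof -
  define P where "P p q = {\<omega>\<in>space M. frac (X \<omega>) \<in> {p..<q}}" for p q
  define \<eta> where "\<eta> = 2 * \<delta> + 2 * real K * B + 1 / (4 * real K * \<delta>\<^sup>2)"
  have \<eta>: "\<eta> \<ge> 0" using \<delta> B0 by (simp add: \<eta>_def)
  have P [measurable]: "P p q \<in> sets M" for p q unfolding P_def by measurable
  have up: "prob (P p q) \<le> q - p + \<eta>" if "p \<le> q" "q \<le> p + 1" for p q
    unfolding P_def \<eta>_def by (rule frac_interval_upper[OF X K that \<delta> B0 B])
  have "space M = P 0 \<alpha> \<union> (P \<alpha> \<alpha>' \<union> P \<alpha>' 1)"
    using \<alpha> by (auto simp: P_def frac_lt_1)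
  then have "1 \<le> prob (P 0 \<alpha>) + (prob (P \<alpha> \<alpha>') + prob (P \<alpha>' 1))"
    using prob_space measure_Un_le[OF P, of "P \<alpha> \<alpha>' \<union> P \<alpha>' 1" 0 \<alpha>] measure_Un_le[OF P P, of \<alpha> \<alpha>' \<alpha>' 1]
    by simp
  moreover have "prob (P 0 \<alpha>) \<le> \<alpha> - 0 + \<eta>" "prob (P \<alpha>' 1) \<le> 1 - \<alpha>' + \<eta>" "prob (P \<alpha> \<alpha>') \<le> \<alpha>' - \<alpha> + \<eta>"
    using \<alpha> by (intro up; simp)+
  ultimately show ?thesis unfolding P_def[symmetric] \<eta>_def[symmetric] using \<eta> by linarith
qed

subsection \<open>Chord lengths\<close>

definition chord :: "real \<Rightarrow> real" where
  "chord x = cmod (1 - cis x)"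

text \<open>The half-angle cotangent \<open>cot (x / 2)\<close>, which is \<open>2\<close> times the logarithmic derivative of
  the chord length; it is \<open>0\<close> at the poles.\<close>
definition hcot :: "real \<Rightarrow> real" where
  "hcot x = sin x / (1 - cos x)"

lemma chord_nonneg: "chord x \<ge> 0"
  by (simp add: chord_def)

lemma chord_sq: "(chord x)\<^sup>2 = 2 * (1 - cos x)"
proof -
  have "(chord x)\<^sup>2 = (1 - cos x)\<^sup>2 + (sin x)\<^sup>2"
    by (simp add: chord_def cmod_power2)
  then show ?thesis using sin_cos_squared_add[of x] by (simp add: power2_eq_square algebra_simps)
qed

lemma chord_eq_sqrt: "chord x = sqrt (2 * (1 - cos x))"
  by (metis chord_nonneg chord_sq real_sqrt_unique)

lemma chord_le_2: "chord x \<le> 2"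
  using norm_triangle_ineq4[of 1 "cis x"] by (simp add: chord_def)

lemma chord_eq_0_iff: "chord x = 0 \<longleftrightarrow> cos x = 1"
  by (simp add: chord_eq_sqrt)

lemma chord_minus: "chord (- x) = chord x"
  by (simp add: chord_eq_sqrt)

lemma chord_diff: "chord (x - y) = cmod (cis x - cis y)"
proof -
  have "cmod (cis x - cis y) = cmod (cis y) * cmod (1 - cis (x - y))"
    unfolding norm_mult[symmetric] by (subst norm_minus_commute) (simp add: right_diff_distrib cis_mult)
  then show ?thesis by (simp add: chord_def)
qed

lemma continuous_chord [continuous_intros]:
  "continuous_on A f \<Longrightarrow> continuous_on A (\<lambda>x. chord (f x))"
  unfolding chord_def by (intro continuous_intros)

lemma chord_measurable [measurable]: "chord \<in> borel_measurable borel"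
  by (intro borel_measurable_continuous_onI continuous_intros)

lemma hcot_measurable [measurable]: "hcot \<in> borel_measurable borel"
  unfolding hcot_def[abs_def] by measurable

lemma cis_measurable [measurable]: "cis \<in> borel_measurable borel"
  by (intro borel_measurable_continuous_onI continuous_intros)

lemma hcot_minus: "hcot (- x) = - hcot x"
  by (simp add: hcot_def)

text \<open>The simple zero of \<open>1 - cis x\<close> cancels the pole of the cotangent, leaving a
  polynomial in \<open>cis x\<close>. This lets the derivative of a power of the chord be written
  without a cotangent.\<close>

lemma one_minus_cis_times_hcot:
  assumes "cos x \<noteq> 1"
  shows "(1 - cis x) * hcot x = - \<i> * (1 + cis x)"
proof -
  have "(1 - cis x) * sin x = - \<i> * (1 + cis x) * (1 - cos x)"
    using sin_cos_squared_add[of x]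
    by (auto simp: complex_eq_iff algebra_simps power2_eq_square)
  then show ?thesis using assms by (simp add: hcot_def field_simps)
qed

text \<open>The two-angle version, which eliminates the cotangent once two indices have been
  symmetrised.\<close>

lemma cis_diff_times_hcot:
  assumes "cos (x - y) \<noteq> 1"
  shows "(cis x - cis y) * hcot (x - y) = \<i> * (cis x + cis y)"
proof -
  have "cis x = cis y * cis (x - y)" by (simp add: cis_mult)
  then have "(cis x - cis y) * hcot (x - y) = - cis y * ((1 - cis (x - y)) * hcot (x - y))"
    by (simp add: algebra_simps)
  also have "\<dots> = \<i> * (cis x + cis y)"
    unfolding one_minus_cis_times_hcot[OF assms] \<open>cis x = cis y * cis (x - y)\<close>
    by (simp add: algebra_simps cis_mult)
  finally show ?thesis .
qed

lemma chord_has_derivative: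
  assumes "cos x \<noteq> 1"
  shows "(chord has_real_derivative (hcot x / 2 * chord x)) (at x)"
proof -
  have pos: "2 * (1 - cos x) > 0" using assms cos_le_one[of x] by (simp add: less_le)
  have "((\<lambda>x. sqrt (2 * (1 - cos x))) has_real_derivative (2 * sin x) * (inverse (sqrt (2 * (1 - cos x))) / 2)) (at x)"
    using pos by (auto intro!: derivative_eq_intros)
  moreover have "(2 * sin x) * (inverse (sqrt (2 * (1 - cos x))) / 2) = hcot x / 2 * chord x"
  proof -
    have "chord x \<noteq> 0" using assms by (simp add: chord_eq_0_iff)
    have "hcot x = 2 * sin x / (chord x)\<^sup>2" unfolding chord_sq hcot_def by (simp del: right_diff_distrib_numeral)
    then show ?thesis unfolding chord_eq_sqrt[symmetric] using \<open>chord x \<noteq> 0\<close>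
      by (simp add: field_simps power2_eq_square)
  qed
  ultimately show ?thesis by (simp only: chord_eq_sqrt[abs_def])
qed

lemma chord_powr_has_derivative:
  assumes "cos x \<noteq> 1"
  shows "((\<lambda>x. chord x powr r) has_real_derivative (r / 2 * hcot x * chord x powr r)) (at x)"
proof -
  have pos: "chord x > 0" using assms chord_eq_0_iff chord_nonneg by (metis less_eq_real_def)
  have "((\<lambda>x. chord x powr r) has_real_derivative (r * chord x powr (r - 1) * (hcot x / 2 * chord x))) (at x)"
    using DERIV_fun_powr[OF chord_has_derivative[OF assms] pos, of r] by simp
  moreover have "chord x powr r = chord x powr (r - 1) * chord x"
    using pos by (simp add: powr_diff)
  ultimately show ?thesis by (simp add: mult_ac)
qed

lemma chord_cpowr_has_derivative:
  fixes s :: complex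
  assumes "cos x \<noteq> 1"
  shows "((\<lambda>x. complex_of_real (chord x) powr s) has_vector_derivative
           (s / 2 * hcot x * complex_of_real (chord x) powr s)) (at x)"
proof -
  have pos: "chord x > 0" using assms chord_eq_0_iff chord_nonneg by (metis less_eq_real_def)
  have "((\<lambda>x. complex_of_real (chord x)) has_vector_derivative complex_of_real (hcot x / 2 * chord x)) (at x)"
    using chord_has_derivative[OF assms]
    by (intro has_vector_derivative_of_real) (simp add: has_real_derivative_iff_has_vector_derivative)
  moreover have "((\<lambda>z. z powr s) has_field_derivative (s * complex_of_real (chord x) powr (s - 1))) (at (complex_of_real (chord x)))"
    using pos by (intro has_field_derivative_powr) auto
  ultimately have "((\<lambda>x. complex_of_real (chord x) powr s) has_vector_derivative
      complex_of_real (hcot x / 2 * chord x) * (s * complex_of_real (chord x) powr (s - 1))) (at x)"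
    using field_vector_diff_chain_at by (fastforce simp: o_def)
  moreover have "complex_of_real (chord x) powr s = complex_of_real (chord x) powr (s - 1) * chord x"
    using pos by (simp add: powr_diff)
  ultimately show ?thesis by (simp add: mult_ac)
qed

section \<open>Calculus near vanishing chords\<close>

lemma has_vector_derivative_shift:
  fixes y \<theta> :: real
  assumes "(f has_vector_derivative f') (at (y - \<theta>))"
  shows "((\<lambda>y. f (y - \<theta>)) has_vector_derivative f') (at y)"
proof -
  have "((\<lambda>y. y - \<theta>) has_vector_derivative (1 - 0)) (at y)"
    by (intro has_vector_derivative_diff has_vector_derivative_id has_vector_derivative_const)
  from vector_diff_chain_at[OF this assms] show ?thesis by (simp add: o_def)
qed

text \<open>Supplies the exceptional set for the fundamental theorem of calculus: the points where a
  chord vanishes and its powers may fail to be differentiable.\<close>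

lemma finite_cos_eq_1:
  fixes a b u :: real
  shows "finite {y \<in> {a..b}. cos (y - u) = 1}"
proof (rule finite_subset)
  let ?n = "\<lambda>x. (x - u) / (2 * pi)"
  show "{y \<in> {a..b}. cos (y - u) = 1} \<subseteq> (\<lambda>n. u + 2 * pi * of_int n) ` {\<lfloor>?n a\<rfloor>..\<lceil>?n b\<rceil>}"
  proof
    fix y assume y: "y \<in> {y \<in> {a..b}. cos (y - u) = 1}"
    then obtain n :: int where n: "y - u = of_int n * 2 * pi"
      using cos_one_2pi_int by auto
    then have "of_int n = ?n y" by simp
    then have "?n a \<le> of_int n" "of_int n \<le> ?n b" using y by (auto simp: divide_right_mono)
    then have "n \<in> {\<lfloor>?n a\<rfloor>..\<lceil>?n b\<rceil>}" by (auto simp: floor_le_iff le_ceiling_iff)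
    then show "y \<in> (\<lambda>n. u + 2 * pi * of_int n) ` {\<lfloor>?n a\<rfloor>..\<lceil>?n b\<rceil>}"
      using n by (intro image_eqI[of _ _ n]) (auto simp: algebra_simps)
  qed
qed auto

text \<open>The integrand without modulus has the primitive \<open>2 / r * chord x powr r\<close>,
  continuous because \<open>r > 0\<close>. Where the sine keeps its sign \<open>\<sigma>\<close>,
  the integral of the modulus is therefore a finite difference of boundary values.\<close>

lemma nn_integral_hcot_chord_piece:
  assumes r: "r > 0" and ab: "a \<le> b" and \<sigma>: "\<sigma> \<in> {1, -1}"
    and sgn: "\<And>x. x \<in> {a..b} \<Longrightarrow> \<sigma> * sin x \<ge> 0"
  shows "(\<integral>\<^sup>+x. ennreal \<bar>hcot x * chord x powr r\<bar> * indicator {a..b} x \<partial>lborel) < \<infinity>"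
proof -
  let ?f = "\<lambda>x. \<sigma> * (hcot x * chord x powr r)"
  let ?F = "\<lambda>x. \<sigma> * 2 / r * chord x powr r"
  have "(?f has_integral ?F b - ?F a) {a..b}"
  proof (rule fundamental_theorem_of_calculus_strong[OF finite_cos_eq_1[of a b 0] ab])
    fix x assume "x \<in> {a..b} - {y \<in> {a..b}. cos (y - 0) = 1}"
    then have "cos x \<noteq> 1" by auto
    from DERIV_cmult[OF chord_powr_has_derivative[OF this, of r], of "\<sigma> * 2 / r"] r
    show "(?F has_vector_derivative ?f x) (at x)"
      by (simp add: has_real_derivative_iff_has_vector_derivative[symmetric] field_simps)
  next
    show "continuous_on {a..b} ?F"
      using r by (intro continuous_intros continuous_on_powr' ) (auto simp: chord_nonneg)
  qed
  moreover have nonneg: "?f x \<ge> 0" if "x \<in> {a..b}" for x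
    using sgn[OF that] by (simp add: hcot_def mult.assoc[symmetric])
  ultimately have "(\<integral>\<^sup>+x. ennreal (?f x) * indicator {a..b} x \<partial>lborel) = ennreal (?F b - ?F a)"
    by (intro nn_integral_has_integral_lebesgue')
  also have "(\<integral>\<^sup>+x. ennreal (?f x) * indicator {a..b} x \<partial>lborel)
      = (\<integral>\<^sup>+x. ennreal \<bar>hcot x * chord x powr r\<bar> * indicator {a..b} x \<partial>lborel)"
  proof (rule nn_integral_cong)
    fix x
    have "\<bar>?f x\<bar> = \<bar>hcot x * chord x powr r\<bar>" using \<sigma> by auto
    then show "ennreal (?f x) * indicator {a..b} x = ennreal \<bar>hcot x * chord x powr r\<bar> * indicator {a..b} x"
      using nonneg[of x] by (auto split: split_indicator)
  qed
  finally show ?thesis by simp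
qed

text \<open>Differences of two angles from \<open>[0, 2 * pi)\<close> stay within this range, which
  splits into four intervals of constant sign of the sine.\<close>

lemma nn_integral_hcot_chord:
  assumes r: "r > 0"
  shows "(\<integral>\<^sup>+x. ennreal \<bar>hcot x * chord x powr r\<bar> * indicator {-2*pi..2*pi} x \<partial>lborel) < \<infinity>"
proof -
  let ?I = "\<lambda>a b. \<integral>\<^sup>+x. ennreal \<bar>hcot x * chord x powr r\<bar> * indicator {a..b} x \<partial>lborel"
  have split: "?I a c \<le> ?I a b + ?I b c" for a b c
  proof -
    have "?I a c \<le> (\<integral>\<^sup>+x. ennreal \<bar>hcot x * chord x powr r\<bar> * indicator {a..b} x
        + ennreal \<bar>hcot x * chord x powr r\<bar> * indicator {b..c} x \<partial>lborel)"
      by (intro nn_integral_mono) (auto split: split_indicator)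
    also have "\<dots> = ?I a b + ?I b c" by (rule nn_integral_add) auto
    finally show ?thesis .
  qed
  have 1: "?I 0 pi < \<infinity>"
    by (rule nn_integral_hcot_chord_piece[OF r, of _ _ 1]) (auto intro: sin_ge_zero)
  have 2: "?I pi (2*pi) < \<infinity>"
    by (rule nn_integral_hcot_chord_piece[OF r, of _ _ "-1"]) (auto simp: le_less[of _ "2*pi"] intro: sin_le_zero)
  have 3: "?I (-pi) 0 < \<infinity>"
  proof (rule nn_integral_hcot_chord_piece[OF r, of _ _ "-1"])
    fix x assume "x \<in> {-pi..0}"
    then show "-1 * sin x \<ge> 0" using sin_ge_zero[of "-x"] by simp
  qed auto
  have 4: "?I (-2*pi) (-pi) < \<infinity>"
  proof (rule nn_integral_hcot_chord_piece[OF r, of _ _ 1])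
    fix x assume "x \<in> {-2*pi..-pi}"
    then show "1 * sin x \<ge> 0" using sin_le_zero[of "-x"] by (cases "x = -2*pi") auto
  qed auto
  have "?I (-2*pi) (2*pi) \<le> (?I (-2*pi) (-pi) + ?I (-pi) 0) + (?I 0 pi + ?I pi (2*pi))"
    by (rule order_trans[OF split[of _ _ 0]]) (intro add_mono split)
  also have "\<dots> < \<infinity>" using 1 2 3 4 by simp
  finally show ?thesis .
qed

section \<open>Integration over one period\<close>

definition angle_measure :: "real measure" where
  "angle_measure = restrict_space lborel {0..<2*pi}"

lemma space_angle: "space angle_measure = {0..<2*pi}"
  by (simp add: angle_measure_def space_restrict_space)

lemma angle_measurable: "f \<in> borel_measurable borel \<Longrightarrow> f \<in> borel_measurable angle_measure"
  by (simp add: angle_measure_def measurable_restrict_space1)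

lemma ident_angle_measurable: "(\<lambda>x. x) \<in> borel_measurable angle_measure"
  by (intro angle_measurable) simp

lemma emeasure_angle_space: "emeasure angle_measure (space angle_measure) = 2 * pi"
  by (simp add: angle_measure_def emeasure_restrict_space space_restrict_space)

interpretation angle_measure: finite_measure angle_measure
  by standard (simp add: emeasure_angle_space)

text \<open>Integration by parts on the circle: the boundary values agree by periodicity.
  Integrability is assumed, since it lets the Lebesgue integral be evaluated through the gauge
  integral of the fundamental theorem.\<close>

lemma integral_angle_derivative_eq_0:
  fixes f f' :: "real \<Rightarrow> complex"
  assumes S: "finite S" and cont: "continuous_on {0..2*pi} f" and per: "f 0 = f (2*pi)"
    and der: "\<And>x. x \<in> {0..2*pi} - S \<Longrightarrow> (f has_vector_derivative f' x) (at x)"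
    and int: "integrable angle_measure f'"
  shows "integral\<^sup>L angle_measure f' = 0"
proof -
  have si: "set_integrable lborel {0..<2*pi} f'"
    using int unfolding angle_measure_def set_integrable_def by (subst (asm) integrable_restrict_space) auto
  have "integral\<^sup>L angle_measure f' = (LINT x:{0..<2*pi}|lborel. f' x)"
    unfolding angle_measure_def set_lebesgue_integral_def by (subst integral_restrict_space) auto
  also have "\<dots> = integral {0..<2*pi} f'"
    by (rule set_borel_integral_eq_integral(2)[OF si])
  also have "(f' has_integral (f (2*pi) - f 0)) {0..2*pi}"
    by (rule fundamental_theorem_of_calculus_strong[OF S _ der cont]) auto
  then have "(f' has_integral (f (2*pi) - f 0)) {0..<2*pi}"
    by (subst has_integral_spike_set_eq[where T = "{0..2*pi}"])
       (auto intro: negligible_subset[OF negligible_sing[of "2*pi"]])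
  then have "integral {0..<2*pi} f' = 0" using per by (simp add: integral_unique)
  finally show ?thesis .
qed

subsection \<open>Products of angles\<close>

interpretation angles: product_sigma_finite "\<lambda>_::nat. angle_measure"
  by standard

lemma finite_measure_PiM_angle: "finite I \<Longrightarrow> finite_measure (PiM I (\<lambda>_::nat. angle_measure))"
proof
  assume I: "finite I"
  have "emeasure (PiM I (\<lambda>_. angle_measure)) (space (PiM I (\<lambda>_. angle_measure))) = (\<Prod>i\<in>I. emeasure angle_measure (space angle_measure))"
    unfolding space_PiM by (rule angles.emeasure_PiM[OF I]) auto
  then show "emeasure (PiM I (\<lambda>_. angle_measure)) (space (PiM I (\<lambda>_. angle_measure))) \<noteq> \<infinity>"
    by (simp add: emeasure_angle_space ennreal_power ennreal_prod_eq_top)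
qed

lemma PiM_angle_component_measurable [measurable]:
  assumes "j \<in> I"
  shows "(\<lambda>\<omega>. \<omega> j) \<in> borel_measurable (PiM I (\<lambda>_::nat. angle_measure))"
proof -
  have "(\<lambda>\<omega>. \<omega> j) \<in> measurable (PiM I (\<lambda>_::nat. angle_measure)) angle_measure"
    using assms by (rule measurable_component_singleton)
  from measurable_compose[OF this ident_angle_measurable] show ?thesis .
qed

text \<open>Exchangeability of identical factors. It suffices to compare the two measures on boxes,
  and the preimage of a box is the box with two sides interchanged.\<close>

lemma distr_PiM_angle_transpose:
  assumes I: "finite I" and a: "a \<in> I" and k: "k \<in> I"
  shows "(\<lambda>\<omega>. \<omega> \<circ> Transposition.transpose a k) \<in> measurable (PiM I (\<lambda>_. angle_measure)) (PiM I (\<lambda>_::nat. angle_measure))" (is "?\<tau> \<in> _")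
    and "distr (PiM I (\<lambda>_. angle_measure)) (PiM I (\<lambda>_::nat. angle_measure)) (\<lambda>\<omega>. \<omega> \<circ> Transposition.transpose a k) = PiM I (\<lambda>_. angle_measure)"
proof -
  let ?M = "PiM I (\<lambda>_::nat. angle_measure)"
  have perm: "Transposition.transpose a k permutes I" using a k by (rule permutes_swap_id)
  have \<tau>: "Transposition.transpose a k j \<in> I \<longleftrightarrow> j \<in> I" for j using perm by (rule permutes_in_image)
  have "(\<lambda>\<omega>. \<lambda>j\<in>I. \<omega> (Transposition.transpose a k j)) \<in> measurable ?M ?M"
    using \<tau> by (intro measurable_restrict measurable_component_singleton) auto
  also have "?this \<longleftrightarrow> ?\<tau> \<in> measurable ?M ?M"
  proof (rule measurable_cong)
    fix \<omega> assume "\<omega> \<in> space ?M"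
    then have "\<omega> j = undefined" if "j \<notin> I" for j
      using that by (auto simp: space_PiM PiE_def extensional_def)
    then show "(\<lambda>j\<in>I. \<omega> (Transposition.transpose a k j)) = \<omega> \<circ> Transposition.transpose a k"
      using \<tau> by (auto simp: fun_eq_iff restrict_def)
  qed
  finally show meas: "?\<tau> \<in> measurable ?M ?M" .
  show "distr ?M ?M ?\<tau> = ?M"
  proof (rule angles.PiM_eqI[OF I])
    fix A assume A: "\<And>i. i \<in> I \<Longrightarrow> A i \<in> sets angle_measure"
    have sub: "A i \<subseteq> space angle_measure" if "i \<in> I" for i using A[OF that] by (rule sets.sets_into_space)
    have "?\<tau> -` Pi\<^sub>E I A \<inter> space ?M = Pi\<^sub>E I (A \<circ> Transposition.transpose a k)"
    proof (intro set_eqI iffI)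
      fix \<omega> assume \<omega>: "\<omega> \<in> ?\<tau> -` Pi\<^sub>E I A \<inter> space ?M"
      have "\<omega> j \<in> A (Transposition.transpose a k j)" if "j \<in> I" for j
      proof -
        have "\<omega> (Transposition.transpose a k (Transposition.transpose a k j)) \<in> A (Transposition.transpose a k j)"
          using \<omega> that \<tau>[of j] by (auto simp: PiE_def Pi_def)
        then show ?thesis by simp
      qed
      then show "\<omega> \<in> Pi\<^sub>E I (A \<circ> Transposition.transpose a k)" using \<omega> by (auto simp: space_PiM PiE_def)
    next
      fix \<omega> assume \<omega>: "\<omega> \<in> Pi\<^sub>E I (A \<circ> Transposition.transpose a k)"
      have 1: "\<omega> (Transposition.transpose a k j) \<in> A j" if "j \<in> I" for j
        using PiE_mem[OF \<omega>, of "Transposition.transpose a k j"] \<tau>[of j] that by simp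
      have 2: "\<omega> (Transposition.transpose a k j) = undefined" if "j \<notin> I" for j
        using \<omega> \<tau>[of j] that by (auto simp: PiE_def extensional_def)
      have "\<omega> j \<in> space angle_measure" if "j \<in> I" for j
        using PiE_mem[OF \<omega> that] sub[of "Transposition.transpose a k j"] \<tau>[of j] that by auto
      then show "\<omega> \<in> ?\<tau> -` Pi\<^sub>E I A \<inter> space ?M"
        using 1 2 \<omega> by (auto simp: space_PiM PiE_def extensional_def)
    qed
    then have "emeasure (distr ?M ?M ?\<tau>) (Pi\<^sub>E I A) = emeasure ?M (Pi\<^sub>E I (A \<circ> Transposition.transpose a k))"
      using A I by (subst emeasure_distr[OF meas]) (auto intro: sets_PiM_I_finite)
    also have "\<dots> = (\<Prod>i\<in>I. emeasure angle_measure ((A \<circ> Transposition.transpose a k) i))"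
      using A \<tau> by (intro angles.emeasure_PiM[OF I]) auto
    also have "\<dots> = (\<Prod>i\<in>I. emeasure angle_measure (A i))"
      using prod.permute[OF perm, of "\<lambda>i. emeasure angle_measure (A i)"] by (simp add: o_def)
    finally show "emeasure (distr ?M ?M ?\<tau>) (Pi\<^sub>E I A) = (\<Prod>i\<in>I. emeasure angle_measure (A i))" .
  qed simp
qed

lemma integral_PiM_angle_transpose:
  fixes f :: "(nat \<Rightarrow> real) \<Rightarrow> complex"
  assumes "finite I" "a \<in> I" "k \<in> I" and f: "f \<in> borel_measurable (PiM I (\<lambda>_. angle_measure))"
  shows "(\<integral>\<omega>. f (\<omega> \<circ> Transposition.transpose a k) \<partial>PiM I (\<lambda>_. angle_measure)) = (\<integral>\<omega>. f \<omega> \<partial>PiM I (\<lambda>_. angle_measure))"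
  using integral_distr[OF distr_PiM_angle_transpose(1)[OF assms(1-3)] f]
  by (simp add: distr_PiM_angle_transpose(2)[OF assms(1-3)])

text \<open>By Tonelli the angle \<open>a\<close> is integrated first. After a translation the inner
  integral is bounded by the constant \<open>C\<close>, whatever the other angles are, and the
  remaining measure is finite.\<close>

lemma integrable_hcot_chord:
  assumes I: "finite I" and a: "a \<in> I" and k: "k \<in> I" and ak: "a \<noteq> k" and r: "r > 0"
  shows "integrable (PiM I (\<lambda>_::nat. angle_measure)) (\<lambda>\<omega>. hcot (\<omega> a - \<omega> k) * chord (\<omega> a - \<omega> k) powr r)"
proof (rule integrableI_bounded)
  let ?g = "\<lambda>x. hcot x * chord x powr r"
  note [measurable] = PiM_angle_component_measurable[OF a] PiM_angle_component_measurable[OF k]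
  show meas: "(\<lambda>\<omega>. ?g (\<omega> a - \<omega> k)) \<in> borel_measurable (PiM I (\<lambda>_::nat. angle_measure))"
    by measurable
  define J where "J = I - {a}"
  have J: "finite J" "a \<notin> J" "I = insert a J" "k \<in> J" using I a k ak by (auto simp: J_def)
  define C where "C = (\<integral>\<^sup>+x. ennreal \<bar>?g x\<bar> * indicator {-2*pi..2*pi} x \<partial>lborel)"
  have C: "C < \<infinity>" unfolding C_def by (rule nn_integral_hcot_chord[OF r])
  interpret J: finite_measure "PiM J (\<lambda>_::nat. angle_measure)" by (rule finite_measure_PiM_angle[OF J(1)])
  have "(\<integral>\<^sup>+\<omega>. ennreal (norm (?g (\<omega> a - \<omega> k))) \<partial>PiM I (\<lambda>_. angle_measure))
      = (\<integral>\<^sup>+x. \<integral>\<^sup>+y. ennreal (norm (?g ((x(a:=y)) a - (x(a:=y)) k))) \<partial>angle_measure \<partial>PiM J (\<lambda>_. angle_measure))"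
    unfolding J(3) using meas by (intro angles.product_nn_integral_insert[OF J(1,2)]) (simp add: J(3))
  also have "\<dots> \<le> (\<integral>\<^sup>+x. C \<partial>PiM J (\<lambda>_. angle_measure))"
  proof (rule nn_integral_mono)
    fix x assume "x \<in> space (PiM J (\<lambda>_::nat. angle_measure))"
    then have xk: "0 \<le> x k" "x k < 2 * pi" using J(4) by (auto simp: space_PiM space_angle PiE_def Pi_def)
    have "(\<integral>\<^sup>+y. ennreal (norm (?g ((x(a:=y)) a - (x(a:=y)) k))) \<partial>angle_measure)
        = (\<integral>\<^sup>+y. ennreal \<bar>?g (y - x k)\<bar> * indicator {0..<2*pi} y \<partial>lborel)"
      using ak unfolding angle_measure_def by (subst nn_integral_restrict_space) auto
    also have "\<dots> \<le> (\<integral>\<^sup>+y. ennreal \<bar>?g (- x k + 1 * y)\<bar> * indicator {-2*pi..2*pi} (- x k + 1 * y) \<partial>lborel)"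
      using xk by (intro nn_integral_mono) (auto split: split_indicator)
    also have "\<dots> = C"
      unfolding C_def by (subst (2) nn_integral_real_affine[where c = 1 and t = "- x k"]) auto
    finally show "(\<integral>\<^sup>+y. ennreal (norm (?g ((x(a:=y)) a - (x(a:=y)) k))) \<partial>angle_measure) \<le> C" .
  qed
  also have "\<dots> < \<infinity>"
    using C J.emeasure_finite[of "space (PiM J (\<lambda>_::nat. angle_measure))"]
    by (simp add: ennreal_mult_eq_top_iff less_top[symmetric])
  finally show "(\<integral>\<^sup>+\<omega>. ennreal (norm (?g (\<omega> a - \<omega> k))) \<partial>PiM I (\<lambda>_. angle_measure)) < \<infinity>" .
qed

text \<open>Every unordered pair of indices occurs twice in this product, hence the exponent \<open>\<beta> / 2\<close>.\<close>
definition vdm :: "real \<Rightarrow> nat set \<Rightarrow> (nat \<Rightarrow> real) \<Rightarrow> real" where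
  "vdm \<beta> I \<omega> = (\<Prod>j\<in>I. \<Prod>k\<in>I-{j}. chord (\<omega> j - \<omega> k) powr (\<beta> / 2))"

lemma vdm_nonneg: "vdm \<beta> I \<omega> \<ge> 0"
  by (simp add: vdm_def prod_nonneg)

lemma vdm_le:
  assumes "\<beta> > 0"
  shows "vdm \<beta> I \<omega> \<le> (\<Prod>j\<in>I. \<Prod>k\<in>I-{j}. 2 powr (\<beta> / 2))"
  unfolding vdm_def using assms
  by (intro prod_mono conjI prod_nonneg powr_mono2) (auto simp: chord_le_2 chord_nonneg)

lemma vdm_measurable [measurable]: "vdm \<beta> I \<in> borel_measurable (PiM I (\<lambda>_. angle_measure))"
proof -
  have "(\<lambda>\<omega>. \<Prod>j\<in>I. \<Prod>k\<in>I-{j}. chord (\<omega> j - \<omega> k) powr (\<beta> / 2)) \<in> borel_measurable (PiM I (\<lambda>_. angle_measure))"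
    by (intro borel_measurable_prod powr_real_measurable measurable_compose[OF _ chord_measurable]
        borel_measurable_diff PiM_angle_component_measurable borel_measurable_const) auto
  then show ?thesis by (simp add: vdm_def[abs_def])
qed

lemma vdm_cong: "(\<And>j. j \<in> I \<Longrightarrow> \<omega> j = \<omega>' j) \<Longrightarrow> vdm \<beta> I \<omega> = vdm \<beta> I \<omega>'"
  unfolding vdm_def by (intro prod.cong) auto

text \<open>A pair containing \<open>a\<close> occurs once in the row of \<open>a\<close> and once
  in the row of its partner, so the two exponents \<open>\<beta> / 2\<close> add up to
  \<open>\<beta>\<close>.\<close>

lemma vdm_remove:
  assumes I: "finite I" and a: "a \<in> I"
  shows "vdm \<beta> I \<omega> = (\<Prod>k\<in>I-{a}. chord (\<omega> a - \<omega> k) powr \<beta>) * vdm \<beta> (I - {a}) \<omega>"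
proof -
  let ?g = "\<lambda>j k. chord (\<omega> j - \<omega> k) powr (\<beta> / 2)"
  have sym: "?g j k = ?g k j" for j k
    using chord_minus[of "\<omega> j - \<omega> k"] by simp
  have "vdm \<beta> I \<omega> = (\<Prod>k\<in>I-{a}. ?g a k) * (\<Prod>j\<in>I-{a}. \<Prod>k\<in>I-{j}. ?g j k)"
    unfolding vdm_def by (rule prod.remove[OF I a])
  also have "(\<Prod>j\<in>I-{a}. \<Prod>k\<in>I-{j}. ?g j k) = (\<Prod>j\<in>I-{a}. ?g a j * (\<Prod>k\<in>(I-{a})-{j}. ?g j k))"
  proof (rule prod.cong[OF refl])
    fix j assume j: "j \<in> I - {a}"
    have "(\<Prod>k\<in>I-{j}. ?g j k) = ?g j a * (\<Prod>k\<in>(I-{j})-{a}. ?g j k)"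
      using I a j by (intro prod.remove) auto
    also have "(I-{j})-{a} = (I-{a})-{j}" by auto
    finally show "(\<Prod>k\<in>I-{j}. ?g j k) = ?g a j * (\<Prod>k\<in>(I-{a})-{j}. ?g j k)"
      by (simp only: sym[of j a])
  qed
  also have "\<dots> = (\<Prod>j\<in>I-{a}. ?g a j) * vdm \<beta> (I - {a}) \<omega>"
    unfolding vdm_def by (rule prod.distrib)
  finally have "vdm \<beta> I \<omega> = ((\<Prod>k\<in>I-{a}. ?g a k) * (\<Prod>k\<in>I-{a}. ?g a k)) * vdm \<beta> (I - {a}) \<omega>"
    by simp
  also have "(\<Prod>k\<in>I-{a}. ?g a k) * (\<Prod>k\<in>I-{a}. ?g a k) = (\<Prod>k\<in>I-{a}. chord (\<omega> a - \<omega> k) powr \<beta>)"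
    unfolding prod.distrib[symmetric] by (simp flip: powr_add)
  finally show ?thesis .
qed

text \<open>With the product over ordered pairs, invariance is a mere reindexing; a product over
  \<open>j < k\<close> would require sorting each permuted pair.\<close>

lemma vdm_transpose:
  assumes "a \<in> I" "k \<in> I"
  shows "vdm \<beta> I (\<omega> \<circ> Transposition.transpose a k) = vdm \<beta> I \<omega>"
proof -
  let ?\<tau> = "Transposition.transpose a k"
  have perm: "?\<tau> permutes I" using assms by (rule permutes_swap_id)
  have "vdm \<beta> I (\<omega> \<circ> ?\<tau>) = (\<Prod>j\<in>I. \<Prod>i\<in>I-{j}. chord (\<omega> (?\<tau> j) - \<omega> (?\<tau> i)) powr (\<beta> / 2))"
    by (simp add: vdm_def)
  also have "\<dots> = (\<Prod>j\<in>I. \<Prod>i\<in>I-{?\<tau> j}. chord (\<omega> (?\<tau> j) - \<omega> i) powr (\<beta> / 2))"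
  proof (rule prod.cong[OF refl])
    fix j assume j: "j \<in> I"
    have "bij_betw ?\<tau> (I - {j}) (I - {?\<tau> j})"
      using permutes_imp_bij[OF perm] j bij_betw_DiffI[of ?\<tau> I I "{j}" "{?\<tau> j}"] permutes_in_image[OF perm]
      by (auto simp: bij_betw_def)
    then show "(\<Prod>i\<in>I-{j}. chord (\<omega> (?\<tau> j) - \<omega> (?\<tau> i)) powr (\<beta> / 2))
        = (\<Prod>i\<in>I-{?\<tau> j}. chord (\<omega> (?\<tau> j) - \<omega> i) powr (\<beta> / 2))"
      by (rule prod.reindex_bij_betw)
  qed
  also have "\<dots> = vdm \<beta> I \<omega>"
    unfolding vdm_def by (rule prod.reindex_bij_betw[OF permutes_imp_bij[OF perm]])
  finally show ?thesis .
qed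

subsection \<open>Aomoto's recursion\<close>

text \<open>One round of Aomoto's method for a general one-angle weight \<open>h\<close>. The
  assumption \<open>der\<close> says that, with \<open>q = 1 - cis (y - \<theta>)\<close>, the
  derivative of \<open>q * h\<close> is \<open>h\<close> times a polynomial of degree one in
  \<open>q\<close>; its coefficients \<open>A\<close> and \<open>B\<close> then govern the
  recursion. Only boundedness is asked of \<open>h\<close> at the zero of \<open>q\<close>, so that
  imaginary powers of the chord are covered.\<close>

locale circular_aomoto =
  fixes \<beta> \<theta> :: real and h :: "real \<Rightarrow> complex" and A B :: complex and C :: real
  assumes \<beta>: "\<beta> > 0"
    and h_meas [measurable]: "h \<in> borel_measurable borel"
    and h_bound: "\<And>y. cmod (h y) \<le> C"
    and per: "h (2*pi) = h 0"
    and der: "\<And>y. cos (y - \<theta>) \<noteq> 1 \<Longrightarrow> ((\<lambda>y. (1 - cis (y - \<theta>)) * h y) has_vector_derivative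
                (- \<i> * (A - B * (1 - cis (y - \<theta>))) * h y)) (at y)"
begin

definition q :: "real \<Rightarrow> complex" where "q y = 1 - cis (y - \<theta>)"

lemma q_meas [measurable]: "q \<in> borel_measurable borel"
  unfolding q_def[abs_def] by measurable

text \<open>At a zero of \<open>q\<close> the weight \<open>h\<close> may oscillate without a limit,
  but it is bounded, so the product tends to 0.\<close>

lemma cont: "continuous_on X (\<lambda>y. (1 - cis (y - \<theta>)) * h y)" (is "continuous_on X ?g")
proof (intro continuous_at_imp_continuous_on ballI)
  fix y
  show "isCont ?g y"
  proof (cases "cos (y - \<theta>) = 1")
    case False
    then show ?thesis using der has_vector_derivative_continuous by blast
  next
    case True
    then have 0: "1 - cis (y - \<theta>) = 0" using chord_eq_0_iff by (simp add: chord_def)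
    have "((\<lambda>y. C * cmod (1 - cis (y - \<theta>))) \<longlongrightarrow> C * cmod (1 - cis (y - \<theta>))) (at y)"
      by (intro tendsto_intros)
    then have "((\<lambda>y. C * cmod (1 - cis (y - \<theta>))) \<longlongrightarrow> 0) (at y)" unfolding 0 by simp
    moreover have "\<forall>\<^sub>F y in at y. norm (?g y) \<le> C * cmod (1 - cis (y - \<theta>))"
      using h_bound by (intro always_eventually allI) (simp add: norm_mult mult.commute mult_right_mono)
    ultimately have "(?g \<longlongrightarrow> 0) (at y)" by (rule Lim_null_comparison[rotated])
    then show ?thesis by (simp add: isCont_def 0)
  qed
qed

text \<open>Interpolates between the plain weight at \<open>S = {}\<close> and the one with all
  factors \<open>q\<close> at \<open>S = I\<close>; the recursion enlarges \<open>S\<close> by one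
  index at a time.\<close>

definition wt :: "nat set \<Rightarrow> nat set \<Rightarrow> (nat \<Rightarrow> real) \<Rightarrow> complex" where
  "wt I S \<omega> = (\<Prod>j\<in>S. q (\<omega> j)) * (\<Prod>j\<in>I. h (\<omega> j)) * of_real (vdm \<beta> I \<omega>)"

lemma wt_measurable:
  assumes "S \<subseteq> I"
  shows "wt I S \<in> borel_measurable (PiM I (\<lambda>_. angle_measure))"
proof -
  have 1: "(\<lambda>\<omega>. q (\<omega> j)) \<in> borel_measurable (PiM I (\<lambda>_. angle_measure))" if "j \<in> S" for j
    using assms that by (intro measurable_compose[OF _ q_meas] PiM_angle_component_measurable) auto
  have 2: "(\<lambda>\<omega>. h (\<omega> j)) \<in> borel_measurable (PiM I (\<lambda>_. angle_measure))" if "j \<in> I" for j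
    using that by (intro measurable_compose[OF _ h_meas] PiM_angle_component_measurable) auto
  show ?thesis unfolding wt_def[abs_def] using 1 2
    by (intro borel_measurable_times borel_measurable_prod) auto
qed

lemma prefactor_bound:
  "cmod ((\<Prod>j\<in>S. q (\<omega> j)) * (\<Prod>j\<in>I. h (\<omega> j))) \<le> 2 ^ card S * C ^ card I"
proof -
  have "cmod (q y) \<le> 2" for y
    using norm_triangle_ineq4[of 1 "cis (y - \<theta>)"] by (simp add: q_def)
  then have "(\<Prod>j\<in>S. cmod (q (\<omega> j))) \<le> (\<Prod>j\<in>S. 2)" by (intro prod_mono) auto
  moreover have "(\<Prod>j\<in>I. cmod (h (\<omega> j))) \<le> (\<Prod>j\<in>I. C)" using h_bound by (intro prod_mono) auto
  ultimately show ?thesis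
    by (auto simp: norm_mult prod_norm[symmetric] intro!: mult_mono prod_nonneg)
qed

lemma wt_integrable:
  assumes "finite I" "S \<subseteq> I"
  shows "integrable (PiM I (\<lambda>_. angle_measure)) (wt I S)"
proof -
  interpret finite_measure "PiM I (\<lambda>_::nat. angle_measure)"
    by (rule finite_measure_PiM_angle) fact
  let ?K = "2 ^ card S * C ^ card I * (\<Prod>j\<in>I. \<Prod>k\<in>I-{j}. 2 powr (\<beta> / 2))"
  have "cmod (wt I S \<omega>) \<le> ?K" for \<omega>
    unfolding wt_def norm_mult[of "_ * _" "of_real _"] norm_of_real
    using vdm_le[OF \<beta>, of I \<omega>] vdm_nonneg[of \<beta> I \<omega>] prefactor_bound[of \<omega> S I]
    by (intro mult_mono order_trans[OF norm_ge_zero prefactor_bound]) auto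
  then show ?thesis using wt_measurable[OF assms(2)]
    by (intro integrable_const_bound[where B = ?K]) auto
qed

text \<open>The factor \<open>chord powr \<beta>\<close> of the pair \<open>a\<close>,
  \<open>k\<close> is pulled out of the Vandermonde weight to absorb the pole of the cotangent;
  everything else, collected in \<open>R\<close>, is bounded.\<close>

lemma wt_hcot_integrable:
  assumes I: "finite I" and S: "S \<subseteq> I" and a: "a \<in> I" and k: "k \<in> I" and ak: "a \<noteq> k"
  shows "integrable (PiM I (\<lambda>_. angle_measure)) (\<lambda>\<omega>. wt I S \<omega> * hcot (\<omega> a - \<omega> k))"
proof -
  note [measurable] = PiM_angle_component_measurable[OF a] PiM_angle_component_measurable[OF k] wt_measurable[OF S]
  define J where "J = I - {a}"
  define K where "K = 2 ^ card S * C ^ card I * ((\<Prod>i\<in>J-{k}. 2 powr \<beta>) * (\<Prod>j\<in>J. \<Prod>k\<in>J-{j}. 2 powr (\<beta> / 2)))"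
  have J: "finite J" "k \<in> J" using I k ak by (auto simp: J_def)
  let ?g = "\<lambda>x. hcot x * chord x powr \<beta>"
  have bound: "cmod (wt I S \<omega> * hcot (\<omega> a - \<omega> k)) \<le> norm (K * ?g (\<omega> a - \<omega> k))" for \<omega>
  proof -
    define R where "R = (\<Prod>i\<in>J-{k}. chord (\<omega> a - \<omega> i) powr \<beta>) * vdm \<beta> J \<omega>"
    have v: "vdm \<beta> I \<omega> = chord (\<omega> a - \<omega> k) powr \<beta> * R"
      unfolding R_def vdm_remove[OF I a] J_def[symmetric] prod.remove[OF J] by (simp add: mult_ac)
    have R0: "R \<ge> 0" unfolding R_def by (intro mult_nonneg_nonneg prod_nonneg vdm_nonneg) auto
    have R: "R \<le> (\<Prod>i\<in>J-{k}. 2 powr \<beta>) * (\<Prod>j\<in>J. \<Prod>k\<in>J-{j}. 2 powr (\<beta> / 2))"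
      unfolding R_def using \<beta> by (intro mult_mono vdm_le prod_mono prod_nonneg vdm_nonneg conjI powr_mono2)
        (auto simp: chord_le_2 chord_nonneg)
    have "cmod (wt I S \<omega> * hcot (\<omega> a - \<omega> k))
        = cmod ((\<Prod>j\<in>S. q (\<omega> j)) * (\<Prod>j\<in>I. h (\<omega> j))) * R * \<bar>?g (\<omega> a - \<omega> k)\<bar>"
      unfolding wt_def v using R0 by (simp add: norm_mult abs_mult mult_ac)
    also have "\<dots> \<le> K * \<bar>?g (\<omega> a - \<omega> k)\<bar>"
      unfolding K_def using R0 R prefactor_bound[of \<omega> S I]
      by (intro mult_right_mono mult_mono order_trans[OF norm_ge_zero prefactor_bound]) auto
    also have "\<dots> \<le> norm (K * ?g (\<omega> a - \<omega> k))"
      by (simp add: abs_mult mult_right_mono)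
    finally show ?thesis .
  qed
  have "integrable (PiM I (\<lambda>_. angle_measure)) (\<lambda>\<omega>. K * ?g (\<omega> a - \<omega> k))"
    by (intro integrable_mult_right integrable_hcot_chord[OF I a k ak \<beta>])
  then show ?thesis
    by (rule Bochner_Integration.integrable_bound) (use bound in \<open>auto\<close>)
qed

lemma wt_transpose:
  assumes "a \<in> I" "k \<in> I" "S \<subseteq> I"
  shows "wt I S (\<omega> \<circ> Transposition.transpose a k) = wt I (Transposition.transpose a k ` S) \<omega>"
proof -
  let ?\<tau> = "Transposition.transpose a k"
  have "(\<Prod>j\<in>I. h (\<omega> (?\<tau> j))) = (\<Prod>j\<in>I. h (\<omega> j))"
    by (rule prod.reindex_bij_betw[OF permutes_imp_bij[OF permutes_swap_id[OF assms(1,2)]]])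
  moreover have "(\<Prod>j\<in>?\<tau> ` S. q (\<omega> j)) = (\<Prod>j\<in>S. q (\<omega> (?\<tau> j)))"
    by (subst prod.reindex) (auto intro: inj_on_subset[OF inj_on_transpose])
  ultimately show ?thesis
    unfolding wt_def vdm_transpose[OF assms(1,2)] by simp
qed

definition ev :: "nat set \<Rightarrow> nat set \<Rightarrow> complex" where
  "ev I S = (\<integral>\<omega>. wt I S \<omega> \<partial>PiM I (\<lambda>_. angle_measure))"

lemma ev_exchange:
  assumes I: "finite I" and S: "S \<subseteq> I" and a: "a \<in> I - S" and k: "k \<in> I - S"
  shows "ev I (insert k S) = ev I (insert a S)"
proof -
  have img: "Transposition.transpose a k ` insert a S = insert k S"
    using a k by (auto simp: image_iff Transposition.transpose_def)
  have "ev I (insert a S) = (\<integral>\<omega>. wt I (insert a S) (\<omega> \<circ> Transposition.transpose a k) \<partial>PiM I (\<lambda>_. angle_measure))"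
    unfolding ev_def using I S a k by (intro integral_PiM_angle_transpose[symmetric] wt_measurable) auto
  also have "\<dots> = ev I (insert k S)"
    unfolding ev_def using S a k by (subst wt_transpose) (auto simp: img simp del: image_insert)
  finally show ?thesis by simp
qed

text \<open>Swapping the two angles preserves the measure and the Vandermonde weight, while the
  cotangent is odd.\<close>

lemma integral_wt_hcot_swap:
  assumes I: "finite I" and S: "S \<subseteq> I" and a: "a \<in> I" and k: "k \<in> I"
  shows "(\<integral>\<omega>. wt I S \<omega> * hcot (\<omega> a - \<omega> k) \<partial>PiM I (\<lambda>_. angle_measure)) =
     - (\<integral>\<omega>. wt I (Transposition.transpose a k ` S) \<omega> * hcot (\<omega> a - \<omega> k) \<partial>PiM I (\<lambda>_. angle_measure))"
proof -
  note [measurable] = PiM_angle_component_measurable[OF a] PiM_angle_component_measurable[OF k] wt_measurable[OF S]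
  let ?f = "\<lambda>\<omega>. wt I S \<omega> * hcot (\<omega> a - \<omega> k)"
  have "(\<integral>\<omega>. ?f \<omega> \<partial>PiM I (\<lambda>_. angle_measure)) = (\<integral>\<omega>. ?f (\<omega> \<circ> Transposition.transpose a k) \<partial>PiM I (\<lambda>_. angle_measure))"
    by (rule integral_PiM_angle_transpose[OF I a k, symmetric]) measurable
  also have "\<dots> = (\<integral>\<omega>. - (wt I (Transposition.transpose a k ` S) \<omega> * hcot (\<omega> a - \<omega> k)) \<partial>PiM I (\<lambda>_. angle_measure))"
  proof (rule Bochner_Integration.integral_cong[OF refl])
    fix \<omega> :: "nat \<Rightarrow> real"
    show "?f (\<omega> \<circ> Transposition.transpose a k) = - (wt I (Transposition.transpose a k ` S) \<omega> * hcot (\<omega> a - \<omega> k))"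
      using hcot_minus[of "\<omega> a - \<omega> k"] by (simp add: wt_transpose[OF a k S])
  qed
  finally show ?thesis by simp
qed

lemma wt_insert: "finite S \<Longrightarrow> a \<notin> S \<Longrightarrow> wt I (insert a S) \<omega> = q (\<omega> a) * wt I S \<omega>"
  by (simp add: wt_def)

text \<open>If \<open>k\<close> already carries a factor \<open>q\<close>, the weight is symmetric
  in \<open>a\<close> and \<open>k\<close>, and the odd cotangent integrates to 0. Otherwise
  averaging with the swapped integral replaces \<open>q (\<omega> a)\<close> by half of
  \<open>q (\<omega> a) - q (\<omega> k)\<close>, whose product with the cotangent is
  \<open>- \<i> * (2 - q (\<omega> a) - q (\<omega> k))\<close>.\<close>

lemma integral_wt_hcot:
  assumes I: "finite I" and S: "S \<subseteq> I" and a: "a \<in> I - S" and k: "k \<in> I" and ak: "a \<noteq> k"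
  shows "(\<integral>\<omega>. wt I (insert a S) \<omega> * hcot (\<omega> a - \<omega> k) \<partial>PiM I (\<lambda>_. angle_measure)) =
     (if k \<in> S then 0 else - \<i> * (ev I S - ev I (insert a S)))" (is "?T = _")
proof (cases "k \<in> S")
  case True
  then have "Transposition.transpose a k ` insert a S = insert a S"
    using a by (auto simp: image_iff Transposition.transpose_def)
  then have "?T = - ?T"
    using integral_wt_hcot_swap[OF I, of "insert a S" a k] S a k by simp
  then show ?thesis using True by simp
next
  case False
  let ?M = "PiM I (\<lambda>_::nat. angle_measure)"
  have finS: "finite S" using I S finite_subset by blast
  have "Transposition.transpose a k ` insert a S = insert k S"
    using a False by (auto simp: image_iff Transposition.transpose_def)
  then have "?T = - (\<integral>\<omega>. wt I (insert k S) \<omega> * hcot (\<omega> a - \<omega> k) \<partial>?M)"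
    using integral_wt_hcot_swap[OF I, of "insert a S" a k] S a k by simp
  then have "2 * ?T = ?T - (\<integral>\<omega>. wt I (insert k S) \<omega> * hcot (\<omega> a - \<omega> k) \<partial>?M)" by simp
  also have "\<dots> = (\<integral>\<omega>. wt I (insert a S) \<omega> * hcot (\<omega> a - \<omega> k) - wt I (insert k S) \<omega> * hcot (\<omega> a - \<omega> k) \<partial>?M)"
    using I S a k ak by (intro Bochner_Integration.integral_diff[symmetric] wt_hcot_integrable) auto
  also have "\<dots> = (\<integral>\<omega>. - \<i> * ((wt I S \<omega> - wt I (insert a S) \<omega>) + (wt I S \<omega> - wt I (insert k S) \<omega>)) \<partial>?M)"
  proof (rule Bochner_Integration.integral_cong[OF refl])
    fix \<omega> :: "nat \<Rightarrow> real"
    show "wt I (insert a S) \<omega> * hcot (\<omega> a - \<omega> k) - wt I (insert k S) \<omega> * hcot (\<omega> a - \<omega> k)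
        = - \<i> * ((wt I S \<omega> - wt I (insert a S) \<omega>) + (wt I S \<omega> - wt I (insert k S) \<omega>))"
    proof (cases "cos (\<omega> a - \<omega> k) = 1")
      \<comment> \<open>At coinciding angles \<open>hcot\<close> has its default value
        \<open>0\<close> and the cotangent identity fails; the Vandermonde weight vanishes there and
        both sides are 0.\<close>
      case True
      then have "chord (\<omega> a - \<omega> k) = 0" by (simp add: chord_eq_0_iff)
      then have "(\<Prod>k\<in>I-{a}. chord (\<omega> a - \<omega> k) powr \<beta>) = 0"
        using I k ak by (intro prod_zero) auto
      then have "vdm \<beta> I \<omega> = 0" using a by (simp add: vdm_remove[OF I, of a])
      then show ?thesis by (simp add: wt_def)
    next
      case cosn: False
      have "(q (\<omega> a) - q (\<omega> k)) * hcot (\<omega> a - \<omega> k) = - ((cis (\<omega> a - \<theta>) - cis (\<omega> k - \<theta>)) * hcot ((\<omega> a - \<theta>) - (\<omega> k - \<theta>)))"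
        by (simp add: q_def algebra_simps)
      also have "\<dots> = - (\<i> * (cis (\<omega> a - \<theta>) + cis (\<omega> k - \<theta>)))"
        using cosn by (subst cis_diff_times_hcot) auto
      also have "\<dots> = - \<i> * ((1 - q (\<omega> a)) + (1 - q (\<omega> k)))"
        by (simp add: q_def algebra_simps)
      finally have "(q (\<omega> a) - q (\<omega> k)) * hcot (\<omega> a - \<omega> k) * wt I S \<omega> = - \<i> * ((1 - q (\<omega> a)) + (1 - q (\<omega> k))) * wt I S \<omega>"
        by simp
      then show ?thesis
        using finS a False by (simp add: wt_insert algebra_simps)
    qed
  qed
  also have "\<dots> = - \<i> * ((ev I S - ev I (insert a S)) + (ev I S - ev I (insert k S)))"
    unfolding ev_def using I S a k by (simp add: wt_integrable)
  also have "ev I (insert k S) = ev I (insert a S)"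
    using ev_exchange[OF I S a] k False by simp
  finally have "2 * ?T = 2 * (- \<i> * (ev I S - ev I (insert a S)))" by (simp add: algebra_simps)
  then have "?T = - \<i> * (ev I S - ev I (insert a S))" by (subst (asm) mult_cancel_left) simp
  then show ?thesis using False by simp
qed

text \<open>The integrand is, off the vanishing chords, the partial derivative in the angle
  \<open>a\<close> of \<open>wt I (insert a S)\<close>: the first term stems from
  \<open>q * h\<close>, the sum from the logarithmic derivative of the chords at \<open>a\<close>.
  By Fubini it is enough that it integrates to 0 on each fibre.\<close>

lemma integral_total_derivative:
  assumes I: "finite I" and S: "S \<subseteq> I" and a: "a \<in> I - S"
  shows "(\<integral>\<omega>. - \<i> * (A * wt I S \<omega> - B * wt I (insert a S) \<omega>)
      + (\<Sum>k\<in>I-{a}. of_real (\<beta> / 2) * (wt I (insert a S) \<omega> * hcot (\<omega> a - \<omega> k))) \<partial>PiM I (\<lambda>_. angle_measure)) = 0"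
    (is "(\<integral>\<omega>. ?D \<omega> \<partial>_) = 0")
proof -
  define J where "J = I - {a}"
  have J: "finite J" "a \<notin> J" "I = insert a J" using I a by (auto simp: J_def)
  have finS: "finite S" using I S finite_subset by blast
  have int: "integrable (PiM I (\<lambda>_. angle_measure)) ?D"
    using I S a
    by (intro Bochner_Integration.integrable_add Bochner_Integration.integrable_sum integrable_mult_right
        Bochner_Integration.integrable_diff wt_integrable wt_hcot_integrable) auto
  have "(\<integral>\<omega>. ?D \<omega> \<partial>PiM I (\<lambda>_. angle_measure)) = (\<integral>x. (\<integral>y. ?D (x(a:=y)) \<partial>angle_measure) \<partial>PiM J (\<lambda>_. angle_measure))"
    using angles.product_integral_insert[OF J(1,2), of ?D] int by (simp only: J(3)[symmetric])
  also have "\<dots> = (\<integral>x. 0 \<partial>PiM J (\<lambda>_. angle_measure))"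
  proof (rule Bochner_Integration.integral_cong[OF refl])
    fix x :: "nat \<Rightarrow> real"
    define P where "P y = (\<Prod>k\<in>J. chord (y - x k) powr \<beta>)" for y
    define c where "c = (\<Prod>j\<in>S. q (x j)) * (\<Prod>j\<in>J. h (x j)) * of_real (vdm \<beta> J x)"
    \<comment> \<open>This is \<open>wt I (insert a S)\<close> as a function of the angle
      \<open>a\<close> alone, the other angles being frozen at \<open>x\<close>.\<close>
    define f where "f y = ((1 - cis (y - \<theta>)) * h y) * of_real (P y) * c" for y
    have wtS: "wt I S (x(a:=y)) = h y * of_real (P y) * c" for y
    proof -
      have "vdm \<beta> J (x(a:=y)) = vdm \<beta> J x" using J(2) by (intro vdm_cong) auto
      moreover have "(\<Prod>k\<in>J. chord ((x(a:=y)) a - (x(a:=y)) k) powr \<beta>) = P y"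
        unfolding P_def using J(2) by (intro prod.cong) auto
      ultimately have "vdm \<beta> I (x(a:=y)) = P y * vdm \<beta> J x"
        using vdm_remove[OF I, of a \<beta> "x(a:=y)"] a by (simp add: J_def)
      moreover have "(\<Prod>j\<in>S. q ((x(a:=y)) j)) = (\<Prod>j\<in>S. q (x j))"
        using a by (intro prod.cong) auto
      moreover have "(\<Prod>j\<in>I. h ((x(a:=y)) j)) = h y * (\<Prod>j\<in>J. h (x j))"
      proof -
        have "(\<Prod>j\<in>J. h ((x(a:=y)) j)) = (\<Prod>j\<in>J. h (x j))" using J(2) by (intro prod.cong) auto
        then show ?thesis unfolding J(3) using J(1,2) by simp
      qed
      ultimately show ?thesis by (simp add: wt_def c_def mult_ac)
    qed
    have wtSa: "wt I (insert a S) (x(a:=y)) = q y * (h y * of_real (P y) * c)" for y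
      using wt_insert[OF finS, of a I "x(a:=y)"] a wtS[of y] by simp
    let ?f' = "\<lambda>y. ?D (x(a:=y))"
    have D: "?f' y = (- \<i> * (A - B * q y) * h y) * of_real (P y) * c
        + q y * h y * of_real (\<Sum>k\<in>J. \<beta> / 2 * hcot (y - x k) * P y) * c" for y
    proof -
      have "(\<Sum>k\<in>I-{a}. of_real (\<beta> / 2) * (wt I (insert a S) (x(a:=y)) * hcot ((x(a:=y)) a - (x(a:=y)) k)))
        = (\<Sum>k\<in>J. q y * h y * of_real (\<beta> / 2 * hcot (y - x k) * P y) * c)"
        unfolding J_def[symmetric] using J(2) by (intro sum.cong) (auto simp: wtSa mult_ac)
      then show ?thesis
        unfolding wtS wtSa by (simp add: sum_distrib_left sum_distrib_right algebra_simps)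
    qed
    \<comment> \<open>On the fibre, differentiability can fail only where the moving angle meets
      \<open>\<theta>\<close> or another angle, up to full turns.\<close>
    define Z where "Z = (\<Union>u\<in>insert \<theta> (x ` J). {y \<in> {0..2*pi}. cos (y - u) = 1})"
    have Z: "finite Z" unfolding Z_def using J(1) finite_cos_eq_1 by auto
    have P_per: "P (2*pi) = P 0"
      unfolding P_def by (intro prod.cong) (auto simp: chord_eq_sqrt cos_diff)
    have f_cont: "continuous_on {0..2*pi} f"
    proof -
      have "continuous_on {0..2*pi} P" unfolding P_def using \<beta>
        by (intro continuous_intros continuous_on_powr') (auto simp: chord_nonneg)
      then show ?thesis unfolding f_def by (intro continuous_intros cont)
    qed
    have f_per: "f 0 = f (2*pi)"
    proof -
      have "cis (2*pi - \<theta>) = cis (0 - \<theta>)" by (simp add: complex_eq_iff cos_diff sin_diff)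
      then show ?thesis unfolding f_def by (simp add: per P_per)
    qed
    have f_der: "(f has_vector_derivative ?f' y) (at y)" if y: "y \<in> {0..2*pi} - Z" for y
    proof -
      have cos\<theta>: "cos (y - \<theta>) \<noteq> 1" and cosk: "\<And>k. k \<in> J \<Longrightarrow> cos (y - x k) \<noteq> 1"
        using y by (auto simp: Z_def)
      have "(P has_real_derivative (\<Sum>k\<in>J. (\<beta> / 2 * hcot (y - x k) * chord (y - x k) powr \<beta>)
          * (\<Prod>i\<in>J-{k}. chord (y - x i) powr \<beta>))) (at y)"
        unfolding P_def
      proof (rule has_field_derivative_prod)
        fix k assume "k \<in> J"
        then show "((\<lambda>u. chord (u - x k) powr \<beta>) has_real_derivative \<beta> / 2 * hcot (y - x k) * chord (y - x k) powr \<beta>) (at y)"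
          using has_vector_derivative_shift[where f = "\<lambda>u. chord u powr \<beta>"] chord_powr_has_derivative[OF cosk]
          by (simp add: has_real_derivative_iff_has_vector_derivative)
      qed
      also have "(\<Sum>k\<in>J. (\<beta> / 2 * hcot (y - x k) * chord (y - x k) powr \<beta>) * (\<Prod>i\<in>J-{k}. chord (y - x i) powr \<beta>))
          = (\<Sum>k\<in>J. \<beta> / 2 * hcot (y - x k) * P y)"
        unfolding P_def by (intro sum.cong refl) (simp add: prod.remove[OF J(1)] mult.assoc)
      finally have "((\<lambda>y. complex_of_real (P y)) has_vector_derivative of_real (\<Sum>k\<in>J. \<beta> / 2 * hcot (y - x k) * P y)) (at y)"
        by (intro has_vector_derivative_of_real) (simp add: has_real_derivative_iff_has_vector_derivative)
      from has_vector_derivative_mult[OF der[OF cos\<theta>] this]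
      have "((\<lambda>y. ((1 - cis (y - \<theta>)) * h y) * of_real (P y)) has_vector_derivative
          (((1 - cis (y - \<theta>)) * h y) * of_real (\<Sum>k\<in>J. \<beta> / 2 * hcot (y - x k) * P y)
           + (- \<i> * (A - B * (1 - cis (y - \<theta>))) * h y) * of_real (P y))) (at y)" .
      from has_vector_derivative_mult_left[OF this, of c]
      show ?thesis unfolding f_def[abs_def] D q_def
        by (rule has_vector_derivative_eq_rhs) (simp add: algebra_simps)
    qed
    \<comment> \<open>On a fibre where the derivative is not integrable the Bochner integral is \<open>0\<close> by convention.\<close>
    show "(\<integral>y. ?f' y \<partial>angle_measure) = 0"
    proof (cases "integrable angle_measure ?f'")
      case True
      show ?thesis by (rule integral_angle_derivative_eq_0[OF Z f_cont f_per f_der True])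
    qed (rule not_integrable_integral_eq)
  qed
  finally show ?thesis by simp
qed

text \<open>In the vanishing total derivative the indices in \<open>S\<close> contribute nothing,
  and the \<open>m\<close> remaining ones contribute the same multiple of
  \<open>ev I S - ev I (insert a S)\<close>. Collecting terms adds \<open>m * \<beta> / 2\<close> to
  both \<open>A\<close> and \<open>B\<close>.\<close>

theorem ev_recursion:
  assumes I: "finite I" and S: "S \<subseteq> I" and a: "a \<in> I - S"
  defines "m \<equiv> of_nat (card (I - insert a S)) :: complex"
  shows "(A + of_real (\<beta> / 2) * m) * ev I S = (B + of_real (\<beta> / 2) * m) * ev I (insert a S)"
proof -
  let ?M = "PiM I (\<lambda>_::nat. angle_measure)"
  have int: "integrable ?M (wt I S)" "integrable ?M (wt I (insert a S))"
    "\<And>k. k \<in> I - {a} \<Longrightarrow> integrable ?M (\<lambda>\<omega>. wt I (insert a S) \<omega> * hcot (\<omega> a - \<omega> k))"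
    using I S a by (auto intro!: wt_integrable wt_hcot_integrable)
  have "0 = - \<i> * (A * ev I S - B * ev I (insert a S))
      + (\<Sum>k\<in>I-{a}. of_real (\<beta> / 2) * (\<integral>\<omega>. wt I (insert a S) \<omega> * hcot (\<omega> a - \<omega> k) \<partial>?M))"
  proof -
    have 1: "integrable ?M (\<lambda>\<omega>. - \<i> * (A * wt I S \<omega> - B * wt I (insert a S) \<omega>))"
      using int(1,2) by (intro integrable_mult_right Bochner_Integration.integrable_diff)
    have 2: "integrable ?M (\<lambda>\<omega>. of_real (\<beta> / 2) * (wt I (insert a S) \<omega> * hcot (\<omega> a - \<omega> k)))"
      if "k \<in> I - {a}" for k using int(3)[OF that] by (rule integrable_mult_right)
    have "(\<integral>\<omega>. - \<i> * (A * wt I S \<omega> - B * wt I (insert a S) \<omega>) \<partial>?M) = - \<i> * (A * ev I S - B * ev I (insert a S))"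
      using int(1,2) by (simp add: ev_def)
    moreover have "(\<integral>\<omega>. (\<Sum>k\<in>I-{a}. of_real (\<beta> / 2) * (wt I (insert a S) \<omega> * hcot (\<omega> a - \<omega> k))) \<partial>?M)
        = (\<Sum>k\<in>I-{a}. of_real (\<beta> / 2) * (\<integral>\<omega>. wt I (insert a S) \<omega> * hcot (\<omega> a - \<omega> k) \<partial>?M))"
      by (subst Bochner_Integration.integral_sum[OF 2]) (simp_all only: integral_mult_right_zero)
    moreover note trans[OF integral_total_derivative[OF I S a, symmetric]
        Bochner_Integration.integral_add[OF 1 Bochner_Integration.integrable_sum[OF 2]]]
    ultimately show ?thesis by (simp only:)
  qed
  also have "(\<Sum>k\<in>I-{a}. of_real (\<beta> / 2) * (\<integral>\<omega>. wt I (insert a S) \<omega> * hcot (\<omega> a - \<omega> k) \<partial>?M))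
      = (\<Sum>k\<in>I-{a}. if k \<in> S then 0 else of_real (\<beta> / 2) * (- \<i> * (ev I S - ev I (insert a S))))"
    using integral_wt_hcot[OF I S a] by (intro sum.cong refl) auto
  also have "\<dots> = (\<Sum>k\<in>I - insert a S. of_real (\<beta> / 2) * (- \<i> * (ev I S - ev I (insert a S))))"
    using I by (intro sum.mono_neutral_cong_right) auto
  also have "\<dots> = m * (of_real (\<beta> / 2) * (- \<i> * (ev I S - ev I (insert a S))))"
    by (simp add: m_def)
  finally have "- \<i> * ((A + of_real (\<beta> / 2) * m) * ev I S - (B + of_real (\<beta> / 2) * m) * ev I (insert a S)) = 0"
    by (simp add: algebra_simps)
  then show ?thesis by simp
qed

text \<open>Indices are inserted in increasing order. Inserting \<open>r\<close> leaves
  \<open>N - Suc r\<close> indices outside, so the factors arise in reverse order and are reindexed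
  at the end.\<close>

corollary ev_full:
  "(\<Prod>j<N. A + of_real (\<beta> / 2) * of_nat j) * ev {..<N} {} =
   (\<Prod>j<N. B + of_real (\<beta> / 2) * of_nat j) * ev {..<N} {..<N}"
proof -
  let ?c = "\<lambda>j. of_real (\<beta> / 2) * complex_of_nat j"
  have "(\<Prod>i<r. A + ?c (N - Suc i)) * ev {..<N} {} = (\<Prod>i<r. B + ?c (N - Suc i)) * ev {..<N} {..<r}" if "r \<le> N" for r
    using that
  proof (induction r)
    case (Suc r)
    have "{..<N} - insert r {..<r} = {Suc r..<N}" by auto
    then have step: "(A + ?c (N - Suc r)) * ev {..<N} {..<r} = (B + ?c (N - Suc r)) * ev {..<N} {..<Suc r}"
      using ev_recursion[of "{..<N}" "{..<r}" r] Suc.prems by (simp add: lessThan_Suc)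
    have "(\<Prod>i<Suc r. A + ?c (N - Suc i)) * ev {..<N} {}
        = (A + ?c (N - Suc r)) * ((\<Prod>i<r. A + ?c (N - Suc i)) * ev {..<N} {})"
      by (simp only: prod.lessThan_Suc mult_ac)
    also have "\<dots> = (\<Prod>i<r. B + ?c (N - Suc i)) * ((A + ?c (N - Suc r)) * ev {..<N} {..<r})"
      using Suc by (simp add: mult_ac)
    also have "\<dots> = (\<Prod>i<Suc r. B + ?c (N - Suc i)) * ev {..<N} {..<Suc r}"
      unfolding step by (simp only: prod.lessThan_Suc mult_ac)
    finally show ?case .
  qed simp
  from this[of N] show ?thesis
    using prod.nat_diff_reindex[of "\<lambda>j. A + ?c j" N] prod.nat_diff_reindex[of "\<lambda>j. B + ?c j" N] by simp
qed

end

subsection \<open>Moments of the characteristic polynomial\<close>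

lemma cis_shift_has_vector_derivative:
  "((\<lambda>y. cis (y - \<theta>)) has_vector_derivative \<i> * cis (y - \<theta>)) (at y)"
  by (rule has_vector_derivative_shift)
     (auto simp: has_vector_derivative_def intro!: derivative_eq_intros)

text \<open>Both kinds of \<open>powr\<close> send base \<open>0\<close> to \<open>0\<close>, even
  for exponent 0, so vanishing chords are included. For exponent 0 the resulting deviation from 1
  will concern only a null set of angles.\<close>

lemma norm_chord_cpowr: "cmod (complex_of_real (chord x) powr s) = chord x powr Re s"
  using chord_nonneg[of x] by (cases "chord x = 0") (auto simp: norm_powr_real_powr powr_def)

lemma chord_cpowr_bound:
  assumes "Re s \<ge> 0"
  shows "cmod (complex_of_real (chord x) powr s) \<le> 2 powr Re s"
  unfolding norm_chord_cpowr using assms chord_nonneg chord_le_2 by (intro powr_mono2) auto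

lemma chord_cpowr_measurable [measurable]: "(\<lambda>x. complex_of_real (chord x) powr s) \<in> borel_measurable borel"
proof -
  have "(\<lambda>x. if chord x = 0 then 0 else exp (s * of_real (ln (chord x)))) \<in> borel_measurable borel"
    by measurable
  also have "(\<lambda>x. if chord x = 0 then 0 else exp (s * of_real (ln (chord x)))) = (\<lambda>x. complex_of_real (chord x) powr s)"
    using chord_nonneg by (auto simp: fun_eq_iff powr_def Ln_of_real less_le)
  finally show ?thesis .
qed

lemma chord_periodic: "chord (2 * pi - \<theta>) = chord (0 - \<theta>)"
  by (simp add: chord_eq_sqrt cos_diff)

text \<open>With \<open>q = 1 - cis (y - \<theta>)\<close> one has
  \<open>q' = - \<i> * (1 - q)\<close> and
  \<open>q * hcot (y - \<theta>) = - \<i> * (2 - q)\<close>; adding the first to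
  \<open>s / 2\<close> times the second gives the two coefficients.\<close>

lemma circular_aomoto_chord_powr:
  assumes "\<beta> > 0" "Re s \<ge> 0"
  shows "circular_aomoto \<beta> \<theta> (\<lambda>y. complex_of_real (chord (y - \<theta>)) powr s) (1 + s) (1 + s / 2) (2 powr Re s)"
proof
  fix y assume cosn: "cos (y - \<theta>) \<noteq> 1"
  let ?h = "\<lambda>y. complex_of_real (chord (y - \<theta>)) powr s"
  have h: "(?h has_vector_derivative (s / 2 * hcot (y - \<theta>) * ?h y)) (at y)"
    by (rule has_vector_derivative_shift[OF chord_cpowr_has_derivative[OF cosn]])
  have q: "((\<lambda>y. 1 - cis (y - \<theta>)) has_vector_derivative (0 - \<i> * cis (y - \<theta>))) (at y)"
    by (intro has_vector_derivative_diff has_vector_derivative_const cis_shift_has_vector_derivative)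
  have "(1 - cis (y - \<theta>)) * (s / 2 * hcot (y - \<theta>) * ?h y) + (0 - \<i> * cis (y - \<theta>)) * ?h y
      = (s / 2 * ((1 - cis (y - \<theta>)) * hcot (y - \<theta>)) - \<i> * cis (y - \<theta>)) * ?h y"
    by (simp add: field_simps)
  also have "\<dots> = - \<i> * ((1 + s) - (1 + s / 2) * (1 - cis (y - \<theta>))) * ?h y"
    unfolding one_minus_cis_times_hcot[OF cosn] by (simp add: algebra_simps)
  finally show "((\<lambda>y. (1 - cis (y - \<theta>)) * ?h y) has_vector_derivative
      - \<i> * ((1 + s) - (1 + s / 2) * (1 - cis (y - \<theta>))) * ?h y) (at y)"
    using has_vector_derivative_mult[OF q h] by simp
qed (use assms chord_cpowr_bound in \<open>auto simp: chord_periodic[simplified]\<close>)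

lemma one_minus_cis_times_cnj: "(1 - cis x) * cnj (1 - cis x) = of_real ((chord x)\<^sup>2)"
  by (simp only: chord_def complex_norm_square)

text \<open>Here \<open>q * h\<close> is the real square \<open>2 * (1 - cos (y - \<theta>))\<close>
  times the power of the chord. The square turns the cotangent into
  \<open>2 * sin (y - \<theta>) = - \<i> * (2 - q) * cnj q\<close>, which restores the factor
  \<open>cnj q\<close> of \<open>h\<close>.\<close>

lemma circular_aomoto_cnj_chord_powr:
  assumes "\<beta> > 0" "Re s \<ge> 0"
  shows "circular_aomoto \<beta> \<theta> (\<lambda>y. cnj (1 - cis (y - \<theta>)) * complex_of_real (chord (y - \<theta>)) powr s)
           (2 + s) (1 + s / 2) (2 * 2 powr Re s)"
proof
  let ?h = "\<lambda>y. complex_of_real (chord (y - \<theta>)) powr s"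
  show "(\<lambda>y. cnj (1 - cis (y - \<theta>)) * ?h y) \<in> borel_measurable borel"
    by (simp add: cis_cnj)
  fix y
  show "cmod (cnj (1 - cis (y - \<theta>)) * ?h y) \<le> 2 * 2 powr Re s"
    unfolding norm_mult complex_mod_cnj chord_def[symmetric]
    using assms(2) by (intro mult_mono chord_cpowr_bound chord_le_2) auto
  assume cosn: "cos (y - \<theta>) \<noteq> 1"
  have h: "(?h has_vector_derivative (s / 2 * hcot (y - \<theta>) * ?h y)) (at y)"
    by (rule has_vector_derivative_shift[OF chord_cpowr_has_derivative[OF cosn]])
  have "((\<lambda>y. 2 * (1 - cos (y - \<theta>))) has_real_derivative 2 * sin (y - \<theta>)) (at y)"
    by (auto intro!: derivative_eq_intros)
  then have q: "((\<lambda>y. complex_of_real (2 * (1 - cos (y - \<theta>)))) has_vector_derivative complex_of_real (2 * sin (y - \<theta>))) (at y)"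
    by (intro has_vector_derivative_of_real) (simp add: has_real_derivative_iff_has_vector_derivative)
  have hc: "2 * (1 - cos (y - \<theta>)) * hcot (y - \<theta>) = 2 * sin (y - \<theta>)"
    using cosn by (simp add: hcot_def field_simps)
  have sn: "complex_of_real (2 * sin (y - \<theta>)) = - \<i> * ((1 + cis (y - \<theta>)) * cnj (1 - cis (y - \<theta>)))"
    using sin_cos_squared_add[of "y - \<theta>"] by (simp add: complex_eq_iff algebra_simps power2_eq_square)
  have "complex_of_real (2 * (1 - cos (y - \<theta>))) * (s / 2 * hcot (y - \<theta>) * ?h y) + complex_of_real (2 * sin (y - \<theta>)) * ?h y
      = s / 2 * complex_of_real (2 * (1 - cos (y - \<theta>)) * hcot (y - \<theta>)) * ?h y + complex_of_real (2 * sin (y - \<theta>)) * ?h y"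
    by (simp add: field_simps)
  also have "\<dots> = (1 + s / 2) * complex_of_real (2 * sin (y - \<theta>)) * ?h y"
    unfolding hc by (simp add: algebra_simps)
  also have "\<dots> = - \<i> * ((2 + s) - (1 + s / 2) * (1 - cis (y - \<theta>))) * (cnj (1 - cis (y - \<theta>)) * ?h y)"
    unfolding sn by (simp add: algebra_simps)
  finally have "((\<lambda>y. complex_of_real (2 * (1 - cos (y - \<theta>))) * ?h y) has_vector_derivative
      - \<i> * ((2 + s) - (1 + s / 2) * (1 - cis (y - \<theta>))) * (cnj (1 - cis (y - \<theta>)) * ?h y)) (at y)"
    using has_vector_derivative_mult[OF q h] by (simp only:)
  also have "(\<lambda>y. complex_of_real (2 * (1 - cos (y - \<theta>))) * ?h y) = (\<lambda>y. (1 - cis (y - \<theta>)) * (cnj (1 - cis (y - \<theta>)) * ?h y))"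
    by (simp only: mult.assoc[symmetric] one_minus_cis_times_cnj chord_sq)
  finally show "((\<lambda>y. (1 - cis (y - \<theta>)) * (cnj (1 - cis (y - \<theta>)) * ?h y)) has_vector_derivative
      - \<i> * ((2 + s) - (1 + s / 2) * (1 - cis (y - \<theta>))) * (cnj (1 - cis (y - \<theta>)) * ?h y)) (at y)" .
qed (use assms in \<open>auto simp: chord_periodic[simplified] complex_eq_iff cos_diff sin_diff\<close>)

text \<open>Left unnormalised: the recursion and the comparison with exponent 0 are homogeneous, and
  the value at 0 will turn out to be the normalising constant of the ensemble.\<close>

definition moment :: "real \<Rightarrow> real \<Rightarrow> nat \<Rightarrow> complex \<Rightarrow> complex" where
  "moment \<beta> \<theta> N s = (\<integral>\<omega>. (\<Prod>j<N. complex_of_real (chord (\<omega> j - \<theta>)) powr s) * of_real (vdm \<beta> {..<N} \<omega>)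
      \<partial>PiM {..<N} (\<lambda>_. angle_measure))"

lemma cnj_of_real_powr: "x \<ge> 0 \<Longrightarrow> cnj (complex_of_real x powr s) = complex_of_real x powr cnj s"
  using cnj_powr[of "of_real x" s] by simp

text \<open>The first round runs with the exponent \<open>cnj s\<close> and inserts the factors
  \<open>q\<close>. Its complex conjugate is the integral with factors \<open>cnj q\<close> and
  exponent \<open>s\<close>, which is the starting point of the second round; inserting
  \<open>q\<close> once more completes \<open>\<bar>q\<bar>\<^sup>2\<close>.\<close>

lemma moment_recursion:
  assumes \<beta>: "\<beta> > 0" and s: "Re s \<ge> 0"
  defines "c \<equiv> \<lambda>j. of_real (\<beta> / 2) * complex_of_nat j"
  shows "(\<Prod>j<N. (1 + s / 2 + c j)\<^sup>2) * moment \<beta> \<theta> N (s + 2) =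
         (\<Prod>j<N. (1 + s + c j) * (2 + s + c j)) * moment \<beta> \<theta> N s"
proof -
  let ?x = "\<lambda>y. complex_of_real (chord (y - \<theta>))"
  let ?q = "\<lambda>y. 1 - cis (y - \<theta>)"
  interpret p: circular_aomoto \<beta> \<theta> "\<lambda>y. ?x y powr cnj s" "1 + cnj s" "1 + cnj s / 2" "2 powr Re (cnj s)"
    using \<beta> s by (intro circular_aomoto_chord_powr) auto
  interpret r: circular_aomoto \<beta> \<theta> "\<lambda>y. cnj (?q y) * ?x y powr s" "2 + s" "1 + s / 2" "2 * 2 powr Re s"
    using \<beta> s by (intro circular_aomoto_cnj_chord_powr) auto
  have p0: "cnj (p.ev {..<N} {}) = moment \<beta> \<theta> N s"
    unfolding p.ev_def p.wt_def moment_def Bochner_Integration.integral_cnj[symmetric]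
    by (simp add: cnj_of_real_powr chord_nonneg del: Bochner_Integration.integral_cnj)
  have p1: "cnj (p.ev {..<N} {..<N}) = r.ev {..<N} {}"
    unfolding p.ev_def p.wt_def r.ev_def r.wt_def p.q_def Bochner_Integration.integral_cnj[symmetric]
    by (simp add: cnj_of_real_powr chord_nonneg prod.distrib del: Bochner_Integration.integral_cnj)
  have r1: "r.ev {..<N} {..<N} = moment \<beta> \<theta> N (s + 2)"
  proof -
    have "?q y * (cnj (?q y) * ?x y powr s) = ?x y powr (s + 2)" for y
    proof -
      have "?q y * (cnj (?q y) * ?x y powr s) = (?x y)\<^sup>2 * ?x y powr s"
        by (simp only: mult.assoc[symmetric] one_minus_cis_times_cnj of_real_power)
      also have "\<dots> = ?x y powr (s + 2)"
        by (cases "?x y = 0") (simp_all add: powr_add powr_numeral mult.commute)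
      finally show ?thesis .
    qed
    then show ?thesis
      unfolding r.ev_def r.wt_def r.q_def moment_def prod.distrib[symmetric] by simp
  qed
  have cc: "cnj (c j) = c j" for j by (simp add: c_def)
  have "cnj ((\<Prod>j<N. 1 + cnj s + c j) * p.ev {..<N} {}) = cnj ((\<Prod>j<N. 1 + cnj s / 2 + c j) * p.ev {..<N} {..<N})"
    using p.ev_full[of N] by (simp add: c_def)
  then have 1: "(\<Prod>j<N. 1 + s + c j) * moment \<beta> \<theta> N s = (\<Prod>j<N. 1 + s / 2 + c j) * r.ev {..<N} {}"
    by (simp add: cc p0 p1)
  have 2: "(\<Prod>j<N. 2 + s + c j) * r.ev {..<N} {} = (\<Prod>j<N. 1 + s / 2 + c j) * moment \<beta> \<theta> N (s + 2)"
    using r.ev_full[of N] by (simp only: c_def r1)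
  have "(\<Prod>j<N. (1 + s / 2 + c j)\<^sup>2) * moment \<beta> \<theta> N (s + 2)
      = (\<Prod>j<N. 1 + s / 2 + c j) * ((\<Prod>j<N. 1 + s / 2 + c j) * moment \<beta> \<theta> N (s + 2))"
    by (simp add: power2_eq_square prod.distrib)
  also have "\<dots> = (\<Prod>j<N. 2 + s + c j) * ((\<Prod>j<N. 1 + s / 2 + c j) * r.ev {..<N} {})"
    unfolding 2[symmetric] by (simp only: mult_ac)
  also have "\<dots> = (\<Prod>j<N. (1 + s + c j) * (2 + s + c j)) * moment \<beta> \<theta> N s"
    unfolding 1[symmetric] by (simp add: prod.distrib mult_ac)
  finally show ?thesis .
qed

lemma moment_norm_le:
  assumes "Re s \<ge> 0" "\<beta> > 0"
  shows "cmod (moment \<beta> \<theta> N s) \<le> cmod (moment \<beta> \<theta> N (of_real (Re s)))"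
proof -
  let ?M = "PiM {..<N} (\<lambda>_::nat. angle_measure)"
  let ?f = "\<lambda>s \<omega>. (\<Prod>j<N. complex_of_real (chord (\<omega> j - \<theta>)) powr s) * of_real (vdm \<beta> {..<N} \<omega>)"
  have eq: "cmod (?f s \<omega>) = (\<Prod>j<N. chord (\<omega> j - \<theta>) powr Re s) * vdm \<beta> {..<N} \<omega>" for s \<omega>
    by (simp add: norm_mult prod_norm[symmetric] norm_chord_cpowr vdm_nonneg)
  have re: "?f (of_real (Re s)) \<omega> = of_real ((\<Prod>j<N. chord (\<omega> j - \<theta>) powr Re s) * vdm \<beta> {..<N} \<omega>)" for \<omega>
    by (simp add: powr_of_real chord_nonneg)
  have "cmod (moment \<beta> \<theta> N s) \<le> (\<integral>\<omega>. cmod (?f s \<omega>) \<partial>?M)"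
    unfolding moment_def by (rule integral_norm_bound)
  also have "\<dots> = (\<integral>\<omega>. (\<Prod>j<N. chord (\<omega> j - \<theta>) powr Re s) * vdm \<beta> {..<N} \<omega> \<partial>?M)"
    by (simp only: eq)
  also have "\<dots> \<le> cmod (moment \<beta> \<theta> N (of_real (Re s)))"
    unfolding moment_def re integral_complex_of_real norm_of_real by simp
  finally show ?thesis .
qed

subsection \<open>Decay along the imaginary axis\<close>

lemma pos_power2_add: "x > 0 \<Longrightarrow> x\<^sup>2 + t\<^sup>2 > (0::real)"
  by (simp add: add_pos_nonneg)

lemma sqrt_quotient_mono:
  fixes d a t :: real
  assumes "0 < d" "d \<le> a"
  shows "sqrt (a\<^sup>2 + t\<^sup>2) / sqrt (d\<^sup>2 + t\<^sup>2) \<le> a / d"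
proof (rule power2_le_imp_le)
  have "d\<^sup>2 \<le> a\<^sup>2" using assms by (intro power_mono) auto
  then have "d\<^sup>2 * t\<^sup>2 \<le> a\<^sup>2 * t\<^sup>2" by (intro mult_right_mono) auto
  then have "(a\<^sup>2 + t\<^sup>2) / (d\<^sup>2 + t\<^sup>2) \<le> a\<^sup>2 / d\<^sup>2"
    using assms by (simp add: divide_simps add_pos_nonneg) (simp add: algebra_simps)
  then show "(sqrt (a\<^sup>2 + t\<^sup>2) / sqrt (d\<^sup>2 + t\<^sup>2))\<^sup>2 \<le> (a / d)\<^sup>2"
    by (simp add: power_divide)
qed (use assms in simp)

text \<open>The squared quotient is exactly \<open>a\<^sup>2 / d\<^sup>2\<close> times one minus the
  fraction in the hypothesis, and \<open>1 - x \<le> exp (- x)\<close>. The factor 2 before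
  \<open>\<eta>\<close> compensates for squaring.\<close>

lemma sqrt_quotient_gain:
  fixes d a t \<eta> :: real
  assumes d: "0 < d" "0 < a" and \<eta>: "2 * \<eta> \<le> t\<^sup>2 * (a\<^sup>2 - d\<^sup>2) / (a\<^sup>2 * (d\<^sup>2 + t\<^sup>2))"
  shows "sqrt (a\<^sup>2 + t\<^sup>2) / sqrt (d\<^sup>2 + t\<^sup>2) \<le> a / d * exp (- \<eta>)"
proof (rule power2_le_imp_le)
  have pos: "d\<^sup>2 + t\<^sup>2 > 0" "a\<^sup>2 > 0" "d\<^sup>2 > 0" using d by (auto intro: add_pos_nonneg)
  have "(a\<^sup>2 + t\<^sup>2) / (d\<^sup>2 + t\<^sup>2) = a\<^sup>2 / d\<^sup>2 * (1 - t\<^sup>2 * (a\<^sup>2 - d\<^sup>2) / (a\<^sup>2 * (d\<^sup>2 + t\<^sup>2)))"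
  proof -
    define X Y where "X = t\<^sup>2 * (a\<^sup>2 - d\<^sup>2)" and "Y = d\<^sup>2 + t\<^sup>2"
    have "a\<^sup>2 / d\<^sup>2 * (1 - X / (a\<^sup>2 * Y)) = (a\<^sup>2 * Y - X) / (d\<^sup>2 * Y)"
      using pos by (simp add: Y_def[symmetric] divide_simps)
    also have "a\<^sup>2 * Y - X = d\<^sup>2 * (a\<^sup>2 + t\<^sup>2)" by (simp add: X_def Y_def algebra_simps)
    finally show ?thesis using pos by (simp add: X_def Y_def)
  qed
  also have "\<dots> \<le> a\<^sup>2 / d\<^sup>2 * exp (- (2 * \<eta>))"
    using \<eta> exp_ge_add_one_self[of "- (2 * \<eta>)"] by (intro mult_left_mono) auto
  also have "\<dots> = (a / d * exp (- \<eta>))\<^sup>2"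
    by (simp add: power_divide power_mult_distrib exp_double[symmetric])
  finally show "(sqrt (a\<^sup>2 + t\<^sup>2) / sqrt (d\<^sup>2 + t\<^sup>2))\<^sup>2 \<le> (a / d * exp (- \<eta>))\<^sup>2"
    by (simp add: power_divide)
qed (use assms in simp)

text \<open>Comes from inserting \<open>d \<le> (2 + \<beta> / 2) * j\<close> and
  \<open>a \<le> (2 + \<beta>) * j\<close>, valid for \<open>k < j\<close>, into the gain of a
  quotient; the leading 2 in the denominator belongs to the passage to square roots.\<close>

definition decay_rate :: "real \<Rightarrow> real \<Rightarrow> real" where
  "decay_rate \<beta> t0 = t0\<^sup>2 * (\<beta> / 2) / (2 * (2 + \<beta>) * ((2 + \<beta> / 2)\<^sup>2 + t0\<^sup>2))"

lemma decay_rate_pos: "\<beta> > 0 \<Longrightarrow> t0 > 0 \<Longrightarrow> decay_rate \<beta> t0 > 0"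
  unfolding decay_rate_def by (intro divide_pos_pos mult_pos_pos add_pos_pos zero_less_power) auto

lemma decay_rate_le:
  fixes \<beta> t t0 :: real and j k :: nat
  assumes \<beta>: "\<beta> > 0" and t0: "t0 > 0" and t: "t0 \<le> \<bar>t\<bar>" and kj: "k < j"
  defines "d \<equiv> 2 * real k + 2 + \<beta> / 2 * real j" and "a \<equiv> 2 * real k + 2 + \<beta> * real j"
  shows "2 * (decay_rate \<beta> t0 / (real j)\<^sup>2) \<le> t\<^sup>2 * (a\<^sup>2 - d\<^sup>2) / (a\<^sup>2 * (d\<^sup>2 + t\<^sup>2))"
proof -
  define J where "J = real j"
  have J: "J \<ge> 1" using kj by (simp add: J_def)
  have kJ: "real k + 1 \<le> J" using kj by (simp add: J_def)
  have \<beta>J: "\<beta> * J \<ge> 0" using \<beta> J by simp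
  have dpos: "d > 0" and apos: "a > 0" using \<beta>J by (simp_all add: d_def a_def J_def)
  have ad: "a = d + \<beta> / 2 * J" by (simp add: a_def d_def J_def)
  have dle: "d \<le> (2 + \<beta> / 2) * J" and ale: "a \<le> (2 + \<beta>) * J"
    using kJ by (auto simp: d_def a_def J_def[symmetric] algebra_simps)
  have t2: "t0\<^sup>2 \<le> t\<^sup>2" using t t0 by (metis abs_le_square_iff abs_of_pos)
  have "2 * (decay_rate \<beta> t0 / (real j)\<^sup>2) = t0\<^sup>2 * (\<beta> / 2 * J) / ((2 + \<beta>) * J * (((2 + \<beta> / 2)\<^sup>2 + t0\<^sup>2) * J\<^sup>2))"
  proof -
    have "2 * (T * b / (2 * p * r) / J\<^sup>2) = T * (b * J) / (p * J * (r * J\<^sup>2))" for T b p r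
      using J by (simp add: field_simps)
    then show ?thesis unfolding decay_rate_def J_def[symmetric] .
  qed
  also have "\<dots> \<le> t0\<^sup>2 * (\<beta> / 2 * J) / (a * (d\<^sup>2 + t0\<^sup>2))"
  proof (rule divide_left_mono)
    have "d\<^sup>2 \<le> ((2 + \<beta> / 2) * J)\<^sup>2" using dle dpos by (intro power_mono) auto
    moreover have "t0\<^sup>2 * 1 \<le> t0\<^sup>2 * J\<^sup>2" using J by (intro mult_left_mono) (auto simp: one_le_power)
    moreover have "((2 + \<beta> / 2) * J)\<^sup>2 = (2 + \<beta> / 2)\<^sup>2 * J\<^sup>2" by (rule power_mult_distrib)
    ultimately have "d\<^sup>2 + t0\<^sup>2 \<le> ((2 + \<beta> / 2)\<^sup>2 + t0\<^sup>2) * J\<^sup>2"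
      by (simp only: distrib_right[of "(2 + \<beta> / 2)\<^sup>2"] mult_1_right add_mono)
    then show "a * (d\<^sup>2 + t0\<^sup>2) \<le> (2 + \<beta>) * J * (((2 + \<beta> / 2)\<^sup>2 + t0\<^sup>2) * J\<^sup>2)"
      using ale apos \<beta> J by (intro mult_mono) auto
    show "0 \<le> t0\<^sup>2 * (\<beta> / 2 * J)" using \<beta> J by auto
    have "a * (d\<^sup>2 + t0\<^sup>2) > 0" using apos dpos by (intro mult_pos_pos add_pos_nonneg) auto
    moreover have "(2 + \<beta>) * J * (((2 + \<beta> / 2)\<^sup>2 + t0\<^sup>2) * J\<^sup>2) > 0"
      using \<beta> J by (intro mult_pos_pos add_pos_nonneg) auto
    ultimately show "0 < (2 + \<beta>) * J * (((2 + \<beta> / 2)\<^sup>2 + t0\<^sup>2) * J\<^sup>2) * (a * (d\<^sup>2 + t0\<^sup>2))"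
      by (rule mult_pos_pos[rotated])
  qed
  also have "\<dots> = t0\<^sup>2 / (d\<^sup>2 + t0\<^sup>2) * (\<beta> / 2 * J / a)" by simp
  \<comment> \<open>The first factor increases with \<open>\<bar>t\<bar>\<close>, which makes the
    bound uniform in \<open>t\<close>; the second uses
    \<open>a\<^sup>2 - d\<^sup>2 = (a + d) * (a - d) \<ge> a * (a - d)\<close>.\<close>
  also have "\<dots> \<le> t\<^sup>2 / (d\<^sup>2 + t\<^sup>2) * ((a\<^sup>2 - d\<^sup>2) / a\<^sup>2)"
  proof (rule mult_mono)
    have "t0\<^sup>2 * d\<^sup>2 \<le> t\<^sup>2 * d\<^sup>2" using t2 by (intro mult_right_mono) auto
    then show "t0\<^sup>2 / (d\<^sup>2 + t0\<^sup>2) \<le> t\<^sup>2 / (d\<^sup>2 + t\<^sup>2)"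
      using dpos by (simp add: divide_simps add_pos_nonneg) (simp add: algebra_simps add_pos_nonneg zero_less_power)
    have "a * (\<beta> / 2 * J) \<le> (a + d) * (\<beta> / 2 * J)" using dpos \<beta> J by (intro mult_right_mono) auto
    also have "\<dots> = a\<^sup>2 - d\<^sup>2" using ad by (simp add: power2_eq_square algebra_simps)
    finally show "\<beta> / 2 * J / a \<le> (a\<^sup>2 - d\<^sup>2) / a\<^sup>2"
      using apos by (simp add: divide_simps power2_eq_square mult_ac)
    show "0 \<le> \<beta> / 2 * J / a" using \<beta> J apos by auto
  qed auto
  also have "\<dots> = t\<^sup>2 * (a\<^sup>2 - d\<^sup>2) / (a\<^sup>2 * (d\<^sup>2 + t\<^sup>2))" by (simp add: mult_ac)
  finally show ?thesis .
qed

text \<open>The factor by which one index contributes to the ratio of the moments at \<open>s\<close> and \<open>s + 2\<close>, where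
  \<open>s = 2 * k + \<i> * t\<close>.\<close>
definition step_factor :: "real \<Rightarrow> nat \<Rightarrow> nat \<Rightarrow> real \<Rightarrow> real" where
  "step_factor \<beta> k j t = ((2 * real k + 2 + \<beta> * real j)\<^sup>2 + t\<^sup>2) / 4 /
     (sqrt ((2 * real k + 1 + \<beta> / 2 * real j)\<^sup>2 + t\<^sup>2) * sqrt ((2 * real k + 2 + \<beta> / 2 * real j)\<^sup>2 + t\<^sup>2))"

lemma step_factor_pos:
  assumes "\<beta> > 0"
  shows "step_factor \<beta> k j t > 0"
proof -
  have "\<beta> * real j \<ge> 0" using assms by simp
  then have "2 * real k + 2 + \<beta> * real j > 0" "2 * real k + 1 + \<beta> / 2 * real j > 0" "2 * real k + 2 + \<beta> / 2 * real j > 0"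
    by simp_all
  then show ?thesis unfolding step_factor_def
    by (intro divide_pos_pos mult_pos_pos real_sqrt_gt_zero pos_power2_add) auto
qed

text \<open>The factor is a product of two quotients with numerator at least the denominator, each
  largest at \<open>t = 0\<close>. For the second claim the quotient with \<open>d2\<close> supplies
  the exponential, and the one with \<open>d1\<close> is bounded by its value at 0.\<close>

lemma step_factor_le:
  assumes \<beta>: "\<beta> > 0"
  shows "step_factor \<beta> k j t \<le> step_factor \<beta> k j 0"
    and "t0 > 0 \<Longrightarrow> t0 \<le> \<bar>t\<bar> \<Longrightarrow> k < j \<Longrightarrow>
      step_factor \<beta> k j t \<le> step_factor \<beta> k j 0 * exp (- decay_rate \<beta> t0 / (real j)\<^sup>2)"
proof -
  define d1 where "d1 = 2 * real k + 1 + \<beta> / 2 * real j"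
  define d2 where "d2 = 2 * real k + 2 + \<beta> / 2 * real j"
  define a where "a = 2 * real k + 2 + \<beta> * real j"
  have "\<beta> * real j \<ge> 0" using \<beta> by simp
  then have pos: "d1 > 0" "d2 > 0" "a > 0" by (simp_all add: d1_def d2_def a_def)
  have le: "d1 \<le> a" "d2 \<le> a" using \<beta> by (auto simp: d1_def d2_def a_def intro!: mult_right_mono)
  have eq: "step_factor \<beta> k j t = (sqrt (a\<^sup>2 + t\<^sup>2) / sqrt (d1\<^sup>2 + t\<^sup>2)) * (sqrt (a\<^sup>2 + t\<^sup>2) / sqrt (d2\<^sup>2 + t\<^sup>2)) / 4" for t
    unfolding step_factor_def d1_def[symmetric] d2_def[symmetric] a_def[symmetric] by simp
  have eq0: "step_factor \<beta> k j 0 = (a / d1) * (a / d2) / 4"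
    unfolding eq using pos by simp
  show "step_factor \<beta> k j t \<le> step_factor \<beta> k j 0"
    unfolding eq[of t] eq0 using pos le by (intro divide_right_mono mult_mono sqrt_quotient_mono) auto
  assume "t0 > 0" "t0 \<le> \<bar>t\<bar>" "k < j"
  from sqrt_quotient_gain[OF pos(2,3) decay_rate_le[OF \<beta> this, folded d2_def a_def]]
  have "step_factor \<beta> k j t \<le> (a / d1) * (a / d2 * exp (- (decay_rate \<beta> t0 / (real j)\<^sup>2))) / 4"
    unfolding eq[of t] using pos le by (intro divide_right_mono mult_mono sqrt_quotient_mono) auto
  then show "step_factor \<beta> k j t \<le> step_factor \<beta> k j 0 * exp (- decay_rate \<beta> t0 / (real j)\<^sup>2)"
    unfolding eq0 by simp
qed

lemma moment_step:
  assumes \<beta>: "\<beta> > 0"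
  shows "cmod (moment \<beta> \<theta> N (Complex (2 * real k) t)) =
     (\<Prod>j<N. step_factor \<beta> k j t) * cmod (moment \<beta> \<theta> N (Complex (2 * real (Suc k)) t))"
proof -
  define s where "s = Complex (2 * real k) t"
  let ?c = "\<lambda>j. of_real (\<beta> / 2) * complex_of_nat j"
  have s2: "s + 2 = Complex (2 * real (Suc k)) t" by (simp add: s_def complex_eq_iff)
  have rec: "(\<Prod>j<N. cmod (1 + s / 2 + ?c j) ^ 2) * cmod (moment \<beta> \<theta> N (s + 2)) =
      (\<Prod>j<N. cmod (1 + s + ?c j) * cmod (2 + s + ?c j)) * cmod (moment \<beta> \<theta> N s)"
    using arg_cong[OF moment_recursion[OF \<beta>, of s N \<theta>], of cmod]
    by (simp add: norm_mult norm_power prod_norm[symmetric] s_def)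
  have 1: "cmod (1 + s / 2 + ?c j) ^ 2 = ((2 * real k + 2 + \<beta> * real j)\<^sup>2 + t\<^sup>2) / 4" for j
    by (simp only: cmod_power2) (simp add: s_def power2_eq_square field_simps)
  have 2: "cmod (1 + s + ?c j) = sqrt ((2 * real k + 1 + \<beta> / 2 * real j)\<^sup>2 + t\<^sup>2)" for j
    by (simp add: s_def cmod_def algebra_simps)
  have 3: "cmod (2 + s + ?c j) = sqrt ((2 * real k + 2 + \<beta> / 2 * real j)\<^sup>2 + t\<^sup>2)" for j
    by (simp add: s_def cmod_def algebra_simps)
  have nz: "cmod (1 + s + ?c j) * cmod (2 + s + ?c j) > 0" for j
  proof -
    have "\<beta> * real j \<ge> 0" using \<beta> by simp
    then have "2 * real k + 1 + \<beta> / 2 * real j > 0" "2 * real k + 2 + \<beta> / 2 * real j > 0" by simp_all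
    then show ?thesis unfolding 2 3
      by (intro mult_pos_pos real_sqrt_gt_zero pos_power2_add) auto
  qed
  then have nz': "(\<Prod>j<N. cmod (1 + s + ?c j) * cmod (2 + s + ?c j)) > 0" by (intro prod_pos) auto
  have "(\<Prod>j<N. step_factor \<beta> k j t) = (\<Prod>j<N. cmod (1 + s / 2 + ?c j) ^ 2 / (cmod (1 + s + ?c j) * cmod (2 + s + ?c j)))"
    unfolding 1 2 3 step_factor_def ..
  also have "\<dots> = (\<Prod>j<N. cmod (1 + s / 2 + ?c j) ^ 2) / (\<Prod>j<N. cmod (1 + s + ?c j) * cmod (2 + s + ?c j))"
    by (rule prod_dividef)
  finally have F: "(\<Prod>j<N. step_factor \<beta> k j t) = \<dots>" .
  have "m1 = F * m2" if "F = P / Q" "P * m2 = Q * m1" "Q > 0" for F P Q m1 m2 :: real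
  proof -
    have "m1 = P * m2 / Q" using that by (simp add: eq_divide_eq mult.commute)
    then show ?thesis using that(1) by simp
  qed
  from this[OF F rec nz'] show ?thesis unfolding s2[symmetric] s_def[symmetric] .
qed

text \<open>For fixed \<open>j\<close> the indices \<open>k < j\<close> together gain
  \<open>exp (- c / j)\<close>, and the product over \<open>j\<close> turns the harmonic sum into a
  power of \<open>N\<close>. The moments at the far end of the two iterations are compared by the
  triangle inequality.\<close>

lemma moment_decay:
  assumes \<beta>: "\<beta> > 0" and t0: "t0 > 0" "t0 \<le> \<bar>t\<bar>" and N: "N \<ge> 1"
  shows "cmod (moment \<beta> \<theta> N (\<i> * of_real t)) \<le> real N powr (- decay_rate \<beta> t0) * cmod (moment \<beta> \<theta> N 0)"
proof -
  let ?m = "\<lambda>k t. cmod (moment \<beta> \<theta> N (Complex (2 * real k) t))"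
  let ?F = "\<lambda>t. \<Prod>k<N. \<Prod>j<N. step_factor \<beta> k j t"
  let ?c = "decay_rate \<beta> t0"
  have iter: "?m 0 t = (\<Prod>k<n. \<Prod>j<N. step_factor \<beta> k j t) * ?m n t" for n t
    by (induction n) (simp_all add: moment_step[OF \<beta>, of \<theta> N _ t, symmetric] mult.assoc moment_step[OF \<beta>, of \<theta> N _ t])
  have Fpos: "?F t > 0" for t by (intro prod_pos step_factor_pos[OF \<beta>] ballI)
  have "(\<Prod>k<N. \<Prod>j<N. step_factor \<beta> k j t) \<le>
      (\<Prod>k<N. \<Prod>j<N. step_factor \<beta> k j 0 * (if k < j then exp (- ?c / (real j)\<^sup>2) else 1))"
    using step_factor_le[OF \<beta>] step_factor_pos[OF \<beta>] t0
    by (intro prod_mono conjI prod_nonneg ballI) (auto intro: less_imp_le)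
  also have "\<dots> = ?F 0 * (\<Prod>j<N. \<Prod>k<N. if k < j then exp (- ?c / (real j)\<^sup>2) else 1)"
    unfolding prod.distrib by (subst (3) prod.swap) simp
  also have "(\<Prod>j<N. \<Prod>k<N. if k < j then exp (- ?c / (real j)\<^sup>2) else 1) = (\<Prod>j<N. exp (- ?c / real j))"
  proof (rule prod.cong[OF refl])
    fix j assume "j \<in> {..<N}"
    then have "(\<Prod>k<N. if k < j then exp (- ?c / (real j)\<^sup>2) else 1) = (\<Prod>k<j. exp (- ?c / (real j)\<^sup>2))"
      by (intro prod.mono_neutral_cong_right) auto
    also have "\<dots> = exp (real j * (- ?c / (real j)\<^sup>2))" by (simp only: prod_constant card_lessThan exp_of_nat_mult)
    \<comment> \<open>At \<open>j = 0\<close> both sides are 0 because division by zero yields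
      \<open>0\<close>, in accordance with the empty range \<open>k < 0\<close>.\<close>
    also have "real j * (- ?c / (real j)\<^sup>2) = - ?c / real j" by (cases "j = 0") (auto simp: power2_eq_square)
    finally show "(\<Prod>k<N. if k < j then exp (- ?c / (real j)\<^sup>2) else 1) = exp (- ?c / real j)" .
  qed
  also have "(\<Prod>j<N. exp (- ?c / real j)) = exp (- ?c * (\<Sum>j<N. 1 / real j))"
    by (simp add: exp_sum[symmetric] sum_distrib_left)
  also have "\<dots> \<le> real N powr (- ?c)"
  proof -
    \<comment> \<open>The sum is the harmonic number of index \<open>N - 1\<close>, which dominates
      \<open>ln N\<close> exactly, so no constant appears in the final bound.\<close>
    obtain n where n: "N = Suc n" using N by (cases N) auto
    have "(\<Sum>j<N. 1 / real j) = harm n"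
      unfolding n harm_def lessThan_Suc_atMost atMost_atLeast0 by (simp add: sum.atLeast_Suc_atMost inverse_eq_divide)
    then have "ln (real N) \<le> (\<Sum>j<N. 1 / real j)" using ln_le_harm[of n] n by (simp add: add.commute)
    then have "?c * ln (real N) \<le> ?c * (\<Sum>j<N. 1 / real j)"
      using decay_rate_pos[OF \<beta> t0(1)] by (intro mult_left_mono) auto
    then show ?thesis using N by (simp add: powr_def)
  qed
  finally have F: "?F t \<le> ?F 0 * real N powr (- ?c)" using Fpos[of 0] by (simp add: mult_left_mono)
  have "?m 0 t = ?F t * ?m N t" by (rule iter)
  also have "\<dots> \<le> (?F 0 * real N powr (- ?c)) * ?m N 0"
    using F moment_norm_le[of "Complex (2 * real N) t" \<beta> \<theta> N] \<beta> Fpos[of t] Fpos[of 0]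
    by (intro mult_mono) (auto simp: Complex_eq)
  also have "\<dots> = real N powr (- ?c) * ?m 0 0"
    unfolding iter[of 0 N] by (simp only: mult_ac)
  finally show ?thesis by (simp add: Complex_eq)
qed

subsection \<open>The circular ensemble\<close>

lemma cbe_base_eq: "cbe_base N = PiM {..<N} (\<lambda>_. angle_measure)"
  by (simp add: cbe_base_def angle_measure_def)

lemma cbe_weight_eq_vdm: "cbe_weight N \<beta> \<omega> = vdm \<beta> {..<N} \<omega>"
proof (induction N)
  case 0
  then show ?case by (simp add: cbe_weight_def vdm_def)
next
  case (Suc N)
  let ?f = "\<lambda>j k. cmod (cis (\<omega> j) - cis (\<omega> k)) powr \<beta>"
  have "cbe_weight (Suc N) \<beta> \<omega> = (\<Prod>j<N. \<Prod>k\<in>{j<..<Suc N}. ?f j k)"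
  proof -
    have "{N<..<Suc N} = {}" by auto
    then show ?thesis unfolding cbe_weight_def prod.lessThan_Suc by (simp only: prod.empty mult_1_right)
  qed
  also have "\<dots> = (\<Prod>j<N. ?f j N * (\<Prod>k\<in>{j<..<N}. ?f j k))"
  proof (rule prod.cong[OF refl])
    fix j assume "j \<in> {..<N}"
    then have "{j<..<Suc N} = insert N {j<..<N}" by auto
    then show "(\<Prod>k\<in>{j<..<Suc N}. ?f j k) = ?f j N * (\<Prod>k\<in>{j<..<N}. ?f j k)" by simp
  qed
  also have "\<dots> = (\<Prod>j<N. ?f j N) * cbe_weight N \<beta> \<omega>"
    unfolding cbe_weight_def by (rule prod.distrib)
  also have "(\<Prod>j<N. ?f j N) = (\<Prod>k\<in>{..<Suc N}-{N}. chord (\<omega> N - \<omega> k) powr \<beta>)"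
    by (intro prod.cong) (auto simp: chord_diff norm_minus_commute)
  also have "\<dots> * cbe_weight N \<beta> \<omega> = vdm \<beta> {..<Suc N} \<omega>"
  proof -
    have "{..<Suc N} - {N} = {..<N}" by auto
    then show ?thesis using vdm_remove[of "{..<Suc N}" N \<beta> \<omega>] Suc.IH by simp
  qed
  finally show ?case .
qed

lemma cmod_charpoly: "cmod (charpoly N \<omega> \<theta>) = (\<Prod>j<N. chord (\<omega> j - \<theta>))"
  unfolding charpoly_def prod_norm[symmetric] chord_diff by (simp add: norm_minus_commute)

lemma cos_diff_eq_1_imp_eq:
  assumes "0 \<le> x" "x < 2 * pi" "0 \<le> y" "y < 2 * pi" "cos (x - y) = 1"
  shows "x = y"
proof -
  obtain n :: int where n: "x - y = of_int n * 2 * pi" using assms(5) cos_one_2pi_int by auto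
  then have "\<bar>of_int n * (2 * pi)\<bar> < 1 * (2 * pi)" using assms by (simp add: mult.assoc)
  then have "\<bar>real_of_int n\<bar> < 1" unfolding abs_mult by simp
  then have "n = 0" by linarith
  then show ?thesis using n by simp
qed

text \<open>With \<open>\<theta>\<close> in the fundamental interval, a factor vanishes only when
  one angle equals \<open>\<theta>\<close>. This event is a box with one side a single point, hence
  null.\<close>

lemma AE_charpoly_nonzero:
  assumes \<theta>: "0 \<le> \<theta>" "\<theta> < 2 * pi"
  shows "AE \<omega> in PiM {..<N} (\<lambda>_::nat. angle_measure). (\<Prod>j<N. chord (\<omega> j - \<theta>)) \<noteq> 0"
proof -
  let ?M = "PiM {..<N} (\<lambda>_::nat. angle_measure)"
  have "AE \<omega> in ?M. chord (\<omega> j - \<theta>) \<noteq> 0" if j: "j < N" for j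
  proof (rule AE_I)
    let ?A = "\<lambda>i. if i = j then {\<theta>} else space angle_measure"
    have set\<theta>: "{\<theta>} \<in> sets angle_measure"
      unfolding angle_measure_def using \<theta> by (subst sets_restrict_space_iff) auto
    have em\<theta>: "emeasure angle_measure {\<theta>} = 0"
      unfolding angle_measure_def using \<theta> by (subst emeasure_restrict_space) auto
    show "{\<omega> \<in> space ?M. \<not> chord (\<omega> j - \<theta>) \<noteq> 0} \<subseteq> Pi\<^sub>E {..<N} ?A"
    proof
      fix \<omega> assume \<omega>: "\<omega> \<in> {\<omega> \<in> space ?M. \<not> chord (\<omega> j - \<theta>) \<noteq> 0}"
      then have \<omega>': "\<omega> \<in> Pi\<^sub>E {..<N} (\<lambda>_. {0..<2*pi})" and cos: "cos (\<omega> j - \<theta>) = 1"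
        by (simp_all add: space_PiM space_angle chord_eq_0_iff)
      have "\<omega> j \<in> {0..<2*pi}" using PiE_mem[OF \<omega>'] j by simp
      then have "\<omega> j = \<theta>" using cos_diff_eq_1_imp_eq[OF _ _ \<theta> cos] by simp
      then show "\<omega> \<in> Pi\<^sub>E {..<N} ?A" using \<omega>' by (simp add: PiE_iff space_angle)
    qed
    have "emeasure ?M (Pi\<^sub>E {..<N} ?A) = (\<Prod>i<N. emeasure angle_measure (?A i))"
      using set\<theta> by (intro angles.emeasure_PiM) auto
    also have "\<dots> = 0" using j em\<theta> by (intro prod_zero bexI[of _ j]) auto
    finally show "emeasure ?M (Pi\<^sub>E {..<N} ?A) = 0" .
    show "Pi\<^sub>E {..<N} ?A \<in> sets ?M" using set\<theta> by (intro sets_PiM_I_finite) auto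
  qed
  then have "AE \<omega> in ?M. \<forall>j\<in>{..<N}. chord (\<omega> j - \<theta>) \<noteq> 0"
    by (intro AE_finite_allI) auto
  then show ?thesis by eventually_elim (simp add: prod_zero_iff)
qed

lemma vdm_integrable:
  assumes "\<beta> > 0"
  shows "integrable (PiM {..<N} (\<lambda>_. angle_measure)) (vdm \<beta> {..<N})"
proof -
  interpret finite_measure "PiM {..<N} (\<lambda>_::nat. angle_measure)" by (rule finite_measure_PiM_angle) simp
  show ?thesis
    by (intro integrable_const_bound[where B = "\<Prod>j<N. \<Prod>k\<in>{..<N}-{j}. 2 powr (\<beta> / 2)"] AE_I2 vdm_measurable)
       (simp only: real_norm_def abs_of_nonneg[OF vdm_nonneg] vdm_le[OF assms])
qed

lemma cbe_normalisation_pos: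
  assumes \<beta>: "\<beta> > 0"
  shows "cbe_normalisation N \<beta> > 0"
proof -
  let ?M = "PiM {..<N} (\<lambda>_::nat. angle_measure)"
  have Z: "cbe_normalisation N \<beta> = (\<integral>\<omega>. vdm \<beta> {..<N} \<omega> \<partial>?M)"
    by (simp add: cbe_normalisation_def cbe_weight_eq_vdm cbe_base_eq)
  \<comment> \<open>The circle is cut into \<open>N\<close> disjoint arcs of equal length. The box
    with angle \<open>j\<close> in arc \<open>j\<close> has positive measure, and its angles are
    pairwise distinct, so the weight is positive on it.\<close>
  define A where "A j = {2 * pi * real j / real N..<2 * pi * (real j + 1) / real N}" for j
  have sub: "A j \<subseteq> {0..<2*pi}" if "j < N" for j
  proof -
    have "real j + 1 \<le> real N" using that by simp
    then have "2 * pi * (real j + 1) \<le> 2 * pi * real N" by (intro mult_left_mono) simp_all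
    then have "2 * pi * (real j + 1) / real N \<le> 2 * pi" using that by (simp add: divide_le_eq)
    moreover have "0 \<le> 2 * pi * real j / real N" by simp
    ultimately show ?thesis unfolding A_def by (auto intro: order_trans less_le_trans)
  qed
  have disj: "x < y" if "x \<in> A j" "y \<in> A k" "j < k" for x y j k
  proof -
    have "2 * pi * (real j + 1) / real N \<le> 2 * pi * real k / real N"
      using that(3) by (intro divide_right_mono mult_left_mono) auto
    then show ?thesis using that unfolding A_def by force
  qed
  have setA: "A j \<in> sets angle_measure" if "j < N" for j
    unfolding angle_measure_def using sub[OF that] by (subst sets_restrict_space_iff) (auto simp: A_def)
  have emA: "emeasure angle_measure (A j) = ennreal (2 * pi / real N)" if "j < N" for j
  proof -
    have "emeasure angle_measure (A j) = emeasure lborel (A j)"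
      unfolding angle_measure_def using sub[OF that] by (subst emeasure_restrict_space) auto
    also have "\<dots> = ennreal (2 * pi * (real j + 1) / real N - 2 * pi * real j / real N)"
      unfolding A_def by (subst emeasure_lborel_Ico) (auto intro!: divide_right_mono)
    also have "2 * pi * (real j + 1) / real N - 2 * pi * real j / real N = 2 * pi / real N"
      by (simp add: diff_divide_distrib[symmetric] algebra_simps)
    finally show ?thesis .
  qed
  have pos: "vdm \<beta> {..<N} \<omega> > 0" if \<omega>: "\<omega> \<in> Pi\<^sub>E {..<N} A" for \<omega>
  proof -
    have "chord (\<omega> j - \<omega> k) \<noteq> 0" if jk: "j < N" "k < N" "j \<noteq> k" for j k
    proof
      assume "chord (\<omega> j - \<omega> k) = 0"
      then have cos: "cos (\<omega> j - \<omega> k) = 1" by (simp only: chord_eq_0_iff)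
      have mem: "\<omega> j \<in> A j" "\<omega> k \<in> A k" using PiE_mem[OF \<omega>] jk by auto
      then have "\<omega> j \<in> {0..<2*pi}" "\<omega> k \<in> {0..<2*pi}" using sub jk by blast+
      then have "\<omega> j = \<omega> k" using cos_diff_eq_1_imp_eq[OF _ _ _ _ cos] by simp
      then show False using disj[OF mem] disj[OF mem(2,1)] jk(3) by (cases "j < k") auto
    qed
    then show ?thesis unfolding vdm_def by (intro prod_pos ballI) (auto simp: less_le)
  qed
  have "(\<integral>\<omega>. vdm \<beta> {..<N} \<omega> \<partial>?M) \<noteq> 0"
  proof
    assume "(\<integral>\<omega>. vdm \<beta> {..<N} \<omega> \<partial>?M) = 0"
    then have "AE \<omega> in ?M. vdm \<beta> {..<N} \<omega> = 0"
      using integral_nonneg_eq_0_iff_AE[OF vdm_integrable[OF \<beta>, of N]] vdm_nonneg by auto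
    then have "AE \<omega> in ?M. \<omega> \<notin> Pi\<^sub>E {..<N} A" by eventually_elim (use pos in force)
    moreover have U: "Pi\<^sub>E {..<N} A \<in> sets ?M" using setA by (intro sets_PiM_I_finite) auto
    moreover have "{\<omega> \<in> space ?M. \<not> \<omega> \<notin> Pi\<^sub>E {..<N} A} = Pi\<^sub>E {..<N} A"
      using sets.sets_into_space[OF U] by auto
    ultimately have "emeasure ?M (Pi\<^sub>E {..<N} A) = 0" by (simp only: AE_iff_measurable)
    moreover have "emeasure ?M (Pi\<^sub>E {..<N} A) = (\<Prod>j<N. ennreal (2 * pi / real N))"
      using setA emA by (subst angles.emeasure_PiM) auto
    ultimately show False by (auto simp: prod_constant ennreal_power)
  qed
  moreover have "(\<integral>\<omega>. vdm \<beta> {..<N} \<omega> \<partial>?M) \<ge> 0" by (intro integral_nonneg_AE) (simp add: vdm_nonneg)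
  ultimately show ?thesis unfolding Z by simp
qed

section \<open>The ensemble as a probability measure\<close>

lemma CbetaE_eq:
  "CbetaE N \<beta> = density (PiM {..<N} (\<lambda>_. angle_measure)) (\<lambda>\<omega>. ennreal (vdm \<beta> {..<N} \<omega> / cbe_normalisation N \<beta>))"
  by (simp add: CbetaE_def cbe_base_eq cbe_weight_eq_vdm)

lemma prob_space_CbetaE:
  assumes \<beta>: "\<beta> > 0"
  shows "prob_space (CbetaE N \<beta>)"
proof
  let ?M = "PiM {..<N} (\<lambda>_::nat. angle_measure)"
  let ?Z = "cbe_normalisation N \<beta>"
  have Z: "?Z > 0" by (rule cbe_normalisation_pos[OF \<beta>])
  have "emeasure (CbetaE N \<beta>) (space (CbetaE N \<beta>)) = (\<integral>\<^sup>+\<omega>. ennreal (vdm \<beta> {..<N} \<omega> / ?Z) \<partial>?M)"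
    unfolding CbetaE_eq by (subst emeasure_density) (auto intro!: nn_integral_cong)
  also have "\<dots> = ennreal (\<integral>\<omega>. vdm \<beta> {..<N} \<omega> / ?Z \<partial>?M)"
    using Z vdm_integrable[OF \<beta>] vdm_nonneg by (intro nn_integral_eq_integral) auto
  also have "(\<integral>\<omega>. vdm \<beta> {..<N} \<omega> / ?Z \<partial>?M) = 1"
    using Z by (simp add: cbe_normalisation_def cbe_weight_eq_vdm cbe_base_eq)
  finally show "emeasure (CbetaE N \<beta>) (space (CbetaE N \<beta>)) = 1" by simp
qed

text \<open>Only almost everywhere do the integrands agree: at a zero of the characteristic
  polynomial the left one follows the convention for \<open>powr\<close> and the right one that for
  \<open>ln\<close>.\<close>

lemma moment_imaginary:
  assumes \<theta>: "0 \<le> \<theta>" "\<theta> < 2 * pi"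
  shows "moment \<beta> \<theta> N (\<i> * of_real t) =
     (\<integral>\<omega>. cis (t * ln (\<Prod>j<N. chord (\<omega> j - \<theta>))) * of_real (vdm \<beta> {..<N} \<omega>) \<partial>PiM {..<N} (\<lambda>_. angle_measure))"
proof -
  let ?M = "PiM {..<N} (\<lambda>_::nat. angle_measure)"
  have c [measurable]: "(\<lambda>\<omega>. chord (\<omega> j - \<theta>)) \<in> borel_measurable ?M" if "j < N" for j
    using that by (intro measurable_compose[OF _ chord_measurable] borel_measurable_diff PiM_angle_component_measurable) auto
  have c': "(\<lambda>\<omega>. complex_of_real (chord (\<omega> j - \<theta>)) powr (\<i> * of_real t)) \<in> borel_measurable ?M" if "j < N" for j
    using that by (intro measurable_compose[OF _ chord_cpowr_measurable] borel_measurable_diff PiM_angle_component_measurable) auto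
  have P: "(\<lambda>\<omega>. \<Prod>j<N. chord (\<omega> j - \<theta>)) \<in> borel_measurable ?M"
    by (intro borel_measurable_prod c) auto
  show ?thesis unfolding moment_def
  proof (rule integral_cong_AE)
    show "(\<lambda>\<omega>. (\<Prod>j<N. complex_of_real (chord (\<omega> j - \<theta>)) powr (\<i> * of_real t)) * of_real (vdm \<beta> {..<N} \<omega>)) \<in> borel_measurable ?M"
      by (intro borel_measurable_times borel_measurable_prod c') auto
    show "(\<lambda>\<omega>. cis (t * ln (\<Prod>j<N. chord (\<omega> j - \<theta>))) * of_real (vdm \<beta> {..<N} \<omega>)) \<in> borel_measurable ?M"
      using P by measurable
    show "AE \<omega> in ?M. (\<Prod>j<N. complex_of_real (chord (\<omega> j - \<theta>)) powr (\<i> * of_real t)) * of_real (vdm \<beta> {..<N} \<omega>)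
        = cis (t * ln (\<Prod>j<N. chord (\<omega> j - \<theta>))) * of_real (vdm \<beta> {..<N} \<omega>)"
      using AE_charpoly_nonzero[OF \<theta>]
    proof eventually_elim
      case (elim \<omega>)
      then have pos: "chord (\<omega> j - \<theta>) > 0" if "j < N" for j
        using that chord_nonneg[of "\<omega> j - \<theta>"] by (auto simp: less_le)
      have "(\<Prod>j<N. complex_of_real (chord (\<omega> j - \<theta>)) powr (\<i> * of_real t)) = (\<Prod>j<N. exp (\<i> * of_real (t * ln (chord (\<omega> j - \<theta>)))))"
      proof (rule prod.cong[OF refl])
        fix j assume "j \<in> {..<N}"
        then have "chord (\<omega> j - \<theta>) > 0" using pos by simp
        then show "complex_of_real (chord (\<omega> j - \<theta>)) powr (\<i> * of_real t) = exp (\<i> * of_real (t * ln (chord (\<omega> j - \<theta>))))"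
          by (simp add: powr_def Ln_of_real mult.assoc)
      qed
      also have "\<dots> = exp (\<i> * of_real (t * (\<Sum>j<N. ln (chord (\<omega> j - \<theta>)))))"
        by (simp add: exp_sum[symmetric] sum_distrib_left)
      also have "(\<Sum>j<N. ln (chord (\<omega> j - \<theta>))) = ln (\<Prod>j<N. chord (\<omega> j - \<theta>))"
        using pos by (intro ln_prod[symmetric]) force+
      finally show ?case by (simp add: cis_conv_exp)
    qed
  qed
qed

section \<open>Fourier coefficients and digit probabilities\<close>

lemma charpoly_log_measurable:
  "(\<lambda>\<omega>. log b (cmod (charpoly N \<omega> \<theta>))) \<in> borel_measurable (CbetaE N \<beta>)"
proof -
  have "(\<lambda>\<omega>. \<Prod>j<N. chord (\<omega> j - \<theta>)) \<in> borel_measurable (PiM {..<N} (\<lambda>_::nat. angle_measure))"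
    by (intro borel_measurable_prod measurable_compose[OF _ chord_measurable] borel_measurable_diff PiM_angle_component_measurable) auto
  then show ?thesis unfolding cmod_charpoly CbetaE_eq by simp
qed

text \<open>Frequency \<open>m\<close> in base \<open>b\<close> corresponds to the exponent
  \<open>\<i> * t\<close> with \<open>t = 2 * pi * m / ln b\<close>, so all positive frequencies
  stay above the same threshold \<open>2 * pi / ln b\<close>, and the bound is uniform in
  \<open>m\<close>.\<close>

lemma CbetaE_fourier_decay:
  assumes \<beta>: "\<beta> > 0" and \<theta>: "0 \<le> \<theta>" "\<theta> < 2 * pi" and b: "b > 1" and N: "N \<ge> 1" and m: "m > 0"
  shows "cmod (\<integral>\<omega>. cis (2 * pi * real m * log b (cmod (charpoly N \<omega> \<theta>))) \<partial>CbetaE N \<beta>)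
     \<le> real N powr (- decay_rate \<beta> (2 * pi / ln b))"
proof -
  let ?M = "PiM {..<N} (\<lambda>_::nat. angle_measure)"
  let ?Z = "cbe_normalisation N \<beta>"
  let ?t0 = "2 * pi / ln b"
  define t where "t = 2 * pi * real m / ln b"
  have lnb: "ln b > 0" using b by simp
  have t0: "?t0 > 0" using lnb by simp
  have "?t0 * 1 \<le> ?t0 * real m" using t0 m by (intro mult_left_mono) auto
  then have t: "?t0 \<le> \<bar>t\<bar>" using lnb by (simp add: t_def)
  have Z: "?Z > 0" by (rule cbe_normalisation_pos[OF \<beta>])
  have meas: "(\<lambda>\<omega>. cis (2 * pi * real m * log b (cmod (charpoly N \<omega> \<theta>)))) \<in> borel_measurable ?M"
    using measurable_compose[OF charpoly_log_measurable[of b N \<theta> \<beta>], of "\<lambda>x. cis (2 * pi * real m * x)"]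
    by (simp add: CbetaE_eq)
  have "(\<integral>\<omega>. cis (2 * pi * real m * log b (cmod (charpoly N \<omega> \<theta>))) \<partial>CbetaE N \<beta>)
      = (\<integral>\<omega>. (vdm \<beta> {..<N} \<omega> / ?Z) *\<^sub>R cis (2 * pi * real m * log b (cmod (charpoly N \<omega> \<theta>))) \<partial>?M)"
    unfolding CbetaE_eq using meas Z vdm_nonneg by (intro integral_density) auto
  also have "\<dots> = (\<integral>\<omega>. (cis (t * ln (\<Prod>j<N. chord (\<omega> j - \<theta>))) * of_real (vdm \<beta> {..<N} \<omega>)) / of_real ?Z \<partial>?M)"
    by (intro Bochner_Integration.integral_cong refl)
       (simp add: t_def log_def cmod_charpoly scaleR_conv_of_real mult_ac)
  also have "\<dots> = moment \<beta> \<theta> N (\<i> * of_real t) / of_real ?Z"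
    unfolding moment_imaginary[OF \<theta>] by simp
  finally have "cmod (\<integral>\<omega>. cis (2 * pi * real m * log b (cmod (charpoly N \<omega> \<theta>))) \<partial>CbetaE N \<beta>)
      = cmod (moment \<beta> \<theta> N (\<i> * of_real t)) / ?Z"
    using Z by (simp add: norm_divide)
  also have "\<dots> \<le> real N powr (- decay_rate \<beta> ?t0) * cmod (moment \<beta> \<theta> N 0) / ?Z"
    using Z by (intro divide_right_mono moment_decay[OF \<beta> t0 t N]) auto
  also have "moment \<beta> \<theta> N 0 = of_real ?Z"
    using moment_imaginary[OF \<theta>, of \<beta> N 0]
    by (simp add: cbe_normalisation_def cbe_weight_eq_vdm cbe_base_eq)
  finally show ?thesis using Z by simp
qed

lemma CbetaE_digit_event:
  fixes kd :: "nat \<Rightarrow> nat"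
  assumes \<beta>: "\<beta> > 0" and \<theta>: "0 \<le> \<theta>" "\<theta> < 2 * pi"
    and b: "b \<ge> 2" and l: "l \<ge> 1" and kd: "\<forall>j\<in>{1..l}. kd j < b" and kd1: "kd 1 \<ge> 1"
  defines "\<kappa> \<equiv> real (\<Sum>j=1..l. kd j * b ^ (l - j))"
  shows "measure (CbetaE N \<beta>) {\<omega> \<in> space (CbetaE N \<beta>). \<forall>j\<in>{1..l}. sig_digit b j (cmod (charpoly N \<omega> \<theta>)) = kd j} =
     measure (CbetaE N \<beta>) {\<omega> \<in> space (CbetaE N \<beta>). frac (log (real b) (cmod (charpoly N \<omega> \<theta>)))
        \<in> {log (real b) \<kappa> - (real l - 1)..<log (real b) (\<kappa> + 1) - (real l - 1)}}"
    (is "measure ?C ?A = measure ?C ?B")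
proof (rule measure_eq_AE)
  let ?D = "\<lambda>\<omega>. cmod (charpoly N \<omega> \<theta>)"
  have iff: "(\<forall>j\<in>{1..l}. sig_digit b j (?D \<omega>) = kd j) \<longleftrightarrow> frac (log (real b) (?D \<omega>))
        \<in> {log (real b) \<kappa> - (real l - 1)..<log (real b) (\<kappa> + 1) - (real l - 1)}" if "?D \<omega> \<noteq> 0" for \<omega>
    unfolding \<kappa>_def using that by (intro sig_digits_iff_frac_log[OF b l kd kd1]) auto
  have zero: "\<not> (\<forall>j\<in>{1..l}. sig_digit b j (?D \<omega>) = kd j)" if "?D \<omega> = 0" for \<omega>
    using that l kd1 by (auto simp: sig_digit_def intro!: bexI[of _ 1])
  have D [measurable]: "?D \<in> borel_measurable ?C"
  proof -
    have "(\<lambda>\<omega>. \<Prod>j<N. chord (\<omega> j - \<theta>)) \<in> borel_measurable (PiM {..<N} (\<lambda>_::nat. angle_measure))"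
      by (intro borel_measurable_prod measurable_compose[OF _ chord_measurable] borel_measurable_diff PiM_angle_component_measurable) auto
    then show ?thesis unfolding cmod_charpoly CbetaE_eq by simp
  qed
  from measurable_compose[OF charpoly_log_measurable[of "real b" N \<theta> \<beta>] frac_borel_measurable]
  show B: "?B \<in> sets ?C" by measurable
  \<comment> \<open>For a vanishing polynomial every \<open>sig_digit\<close> is \<open>0\<close>,
    while the prescribed leading digit is not. The digit event is thus the logarithmic event without
    a null set, which also yields its measurability.\<close>
  have "{\<omega> \<in> space ?C. ?D \<omega> \<noteq> 0} \<in> sets ?C" by measurable
  moreover have "?A = ?B \<inter> {\<omega> \<in> space ?C. ?D \<omega> \<noteq> 0}" using iff zero by blast
  ultimately show "?A \<in> sets ?C" using B by simp
  have "AE \<omega> in ?C. ?D \<omega> \<noteq> 0"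
    unfolding CbetaE_eq cmod_charpoly using AE_charpoly_nonzero[OF \<theta>, of N]
    by (subst AE_density) auto
  then show "AE \<omega> in ?C. \<omega> \<in> ?A \<longleftrightarrow> \<omega> \<in> ?B" by eventually_elim (use iff in blast)
qed

text \<open>The Benford probability is the length of the interval of logarithms,
  \<open>log b ((\<kappa> + 1) / \<kappa>)\<close>. The degree \<open>K\<close> and the width
  \<open>\<delta>\<close> stay free, to be balanced against the Fourier decay at the end.\<close>

lemma CbetaE_benford_bound:
  fixes kd :: "nat \<Rightarrow> nat"
  assumes \<beta>: "\<beta> > 0" and \<theta>: "0 \<le> \<theta>" "\<theta> < 2 * pi"
    and b: "b \<ge> 2" and l: "l \<ge> 1" and kd: "\<forall>j\<in>{1..l}. kd j < b" and kd1: "kd 1 \<ge> 1"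
    and N: "N \<ge> 1" and K: "K > 0" and \<delta>: "0 < \<delta>" "\<delta> \<le> 1/2"
  defines "c \<equiv> decay_rate \<beta> (2 * pi / ln (real b))"
  shows "\<bar>measure (CbetaE N \<beta>) {\<omega> \<in> space (CbetaE N \<beta>). \<forall>j\<in>{1..l}. sig_digit b j (cmod (charpoly N \<omega> \<theta>)) = kd j}
      - log (real b) (1 + 1 / (\<Sum>j=1..l. real (kd j) * real b ^ (l - j)))\<bar>
     \<le> 2 * (2 * \<delta> + 2 * real K * real N powr (- c) + 1 / (4 * real K * \<delta>\<^sup>2))"
proof -
  interpret prob_space "CbetaE N \<beta>" by (rule prob_space_CbetaE[OF \<beta>])
  define \<kappa> where "\<kappa> = real (\<Sum>j=1..l. kd j * b ^ (l - j))"
  let ?\<alpha> = "log (real b) \<kappa> - (real l - 1)" and ?\<alpha>' = "log (real b) (\<kappa> + 1) - (real l - 1)"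
  have b1: "real b > 1" using b by simp
  have lower: "real b ^ (l - 1) \<le> \<kappa>"
    using digit_value_bounds(1)[OF b l kd kd1] unfolding \<kappa>_def by (simp only: of_nat_power[symmetric] of_nat_le_iff)
  have upper: "\<kappa> + 1 \<le> real b ^ l"
  proof -
    have "real (Suc (\<Sum>j=1..l. kd j * b ^ (l - j))) \<le> real (b ^ l)"
      using digit_value_bounds(2)[OF b l kd kd1] by (simp only: of_nat_le_iff Suc_le_eq)
    then show ?thesis unfolding \<kappa>_def by (simp only: of_nat_Suc of_nat_power add.commute)
  qed
  have bp: "real b ^ (l - 1) > 0" using b1 by simp
  then have \<kappa>pos: "\<kappa> > 0" using lower by linarith
  have "log (real b) (real b ^ (l - 1)) \<le> log (real b) \<kappa>" using b1 lower \<kappa>pos bp by (subst log_le_cancel_iff) auto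
  then have \<alpha>0: "0 \<le> ?\<alpha>" using b1 l by (simp add: log_nat_power of_nat_diff)
  have "log (real b) (\<kappa> + 1) \<le> log (real b) (real b ^ l)" using b1 upper \<kappa>pos by (subst log_le_cancel_iff) auto
  then have \<alpha>1: "?\<alpha>' \<le> 1" using b1 by (simp add: log_nat_power)
  have \<alpha>\<alpha>: "?\<alpha> \<le> ?\<alpha>'" using b1 \<kappa>pos by simp
  have "?\<alpha>' - ?\<alpha> = log (real b) ((\<kappa> + 1) / \<kappa>)" using b1 \<kappa>pos by (simp add: log_divide)
  also have "(\<kappa> + 1) / \<kappa> = 1 + 1 / (\<Sum>j=1..l. real (kd j) * real b ^ (l - j))"
    using \<kappa>pos unfolding \<kappa>_def by (simp add: add_divide_distrib)
  finally have diff: "?\<alpha>' - ?\<alpha> = log (real b) (1 + 1 / (\<Sum>j=1..l. real (kd j) * real b ^ (l - j)))" .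
  show ?thesis
    unfolding CbetaE_digit_event[OF \<beta> \<theta> b l kd kd1] \<kappa>_def[symmetric] diff[symmetric]
    using CbetaE_fourier_decay[OF \<beta> \<theta> b1 N] unfolding c_def
    by (intro frac_equidistribution[OF charpoly_log_measurable K \<alpha>0 \<alpha>\<alpha> \<alpha>1 \<delta>]) auto
qed

theorem theorem1p1:
  fixes \<beta> :: real and b :: nat and \<theta> :: real and l :: nat
    and kd :: "nat \<Rightarrow> nat" and \<epsilon> :: real
  assumes "\<beta> > 0" and "b \<ge> 2"
    and "0 \<le> \<theta>" and "\<theta> < 2 * pi"
    and "l \<ge> 1"
    and "kd 1 \<in> {1..b-1}"
    and "\<forall>j\<in>{2..l}. kd j \<in> {0..b-1}"
    and "\<epsilon> > 0"
  shows "(\<lambda>N. measure (CbetaE N \<beta>)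
              {\<theta>s \<in> space (CbetaE N \<beta>).
                 \<forall>j\<in>{1..l}. sig_digit b j (cmod (charpoly N \<theta>s \<theta>)) = kd j}
            - log (real b) (1 + 1 / (\<Sum>j=1..l. real (kd j) * real b ^ (l - j))))
         \<in> o(\<lambda>N. ln (real N) powr (-3/2 + \<epsilon>))"
proof -
  define c where "c = decay_rate \<beta> (2 * pi / ln (real b))"
  have c: "c > 0" unfolding c_def using assms by (intro decay_rate_pos) auto
  have kd: "\<forall>j\<in>{1..l}. kd j < b"
  proof
    fix j assume "j \<in> {1..l}"
    then consider "j = 1" | "j \<in> {2..l}" by force
    then show "kd j < b"
    proof cases
      case 2
      then have "kd j \<le> b - 1" using assms(7) by auto
      then show ?thesis using assms(2) by linarith
    qed (use assms(2,6) in auto)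
  qed
  have kd1: "kd 1 \<ge> 1" using assms(6) by simp
  let ?f = "\<lambda>N. measure (CbetaE N \<beta>)
              {\<theta>s \<in> space (CbetaE N \<beta>).
                 \<forall>j\<in>{1..l}. sig_digit b j (cmod (charpoly N \<theta>s \<theta>)) = kd j}
            - log (real b) (1 + 1 / (\<Sum>j=1..l. real (kd j) * real b ^ (l - j)))"
  let ?g = "\<lambda>N::nat. 13 * real N powr (- c / 8)"
  have "((\<lambda>N::nat. real N powr (- c / 8)) \<longlongrightarrow> 0) at_top" using c by real_asymp
  then have "\<forall>\<^sub>F N::nat in at_top. real N powr (- c / 8) < 1/2" by (rule order_tendstoD) simp
  then have "\<forall>\<^sub>F N in at_top. norm (?f N) \<le> ?g N"
    using eventually_ge_at_top[of 1]
  proof eventually_elim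
    case (elim N)
    \<comment> \<open>With degree about \<open>N powr (c / 2)\<close> and width
      \<open>N powr (- c / 8)\<close>, the Fourier term has order \<open>N powr (- c / 2)\<close>
      and the tail term order \<open>N powr (- c / 4)\<close>; both are dominated by the
      width.\<close>
    define K where "K = nat \<lceil>real N powr (c / 2)\<rceil>"
    define \<delta> where "\<delta> = real N powr (- c / 8)"
    have Npos: "real N > 0" using elim by simp
    have pos: "real N powr (c / 2) > 0" using Npos by simp
    have K: "K > 0" "real N powr (c / 2) \<le> real K" "real K \<le> real N powr (c / 2) + 1"
      using pos unfolding K_def by (linarith | simp)+
    have \<delta>: "0 < \<delta>" "\<delta> \<le> 1/2" using elim Npos by (auto simp: \<delta>_def)
    have p: "0 < 4 * real K * \<delta>\<^sup>2" "0 < 4 * real N powr (c / 2) * \<delta>\<^sup>2"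
      using K(1) \<delta>(1) pos by (simp_all add: mult_pos_pos)
    have "1 / (4 * real K * \<delta>\<^sup>2) \<le> 1 / (4 * real N powr (c / 2) * \<delta>\<^sup>2)"
      using K(2) mult_pos_pos[OF p] by (intro divide_left_mono mult_right_mono mult_left_mono) simp_all
    also have "4 * real N powr (c / 2) * \<delta>\<^sup>2 = 4 * real N powr (c / 4)"
      by (simp add: \<delta>_def power2_eq_square powr_add[symmetric])
    also have "1 / (4 * real N powr (c / 4)) = real N powr (- c / 4) / 4"
      by (simp add: powr_minus_divide)
    also have "\<dots> \<le> \<delta> / 4"
      unfolding \<delta>_def using c elim by (intro divide_right_mono powr_mono) auto
    finally have tail: "1 / (4 * real K * \<delta>\<^sup>2) \<le> \<delta> / 4" .
    have "real K * real N powr (- c) \<le> (real N powr (c / 2) + 1) * real N powr (- c)"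
      using K by (intro mult_right_mono) auto
    also have "\<dots> = real N powr (- c / 2) + real N powr (- c)"
      by (simp add: distrib_right powr_add[symmetric])
    also have "\<dots> \<le> \<delta> + \<delta>"
      unfolding \<delta>_def using c elim by (intro add_mono powr_mono) auto
    finally have mid: "real K * real N powr (- c) \<le> \<delta> + \<delta>" .
    have "norm (?f N) \<le> 2 * (2 * \<delta> + 2 * real K * real N powr (- c) + 1 / (4 * real K * \<delta>\<^sup>2))"
      using CbetaE_benford_bound[OF assms(1,3,4,2,5) kd kd1 _ K(1) \<delta>, of N] elim by (simp add: c_def)
    also have "\<dots> \<le> 2 * (2 * \<delta> + 2 * (\<delta> + \<delta>) + \<delta> / 4)"
      using tail mid by simp
    \<comment> \<open>The sum is \<open>12.5 * \<delta>\<close>, which explains the constant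
      13.\<close>
    also have "\<dots> \<le> ?g N" using \<delta>(1) unfolding \<delta>_def[symmetric] by simp
    finally show ?case .
  qed
  then have "?f \<in> O(?g)"
    by (intro landau_o.bigI[of 1]) (auto elim!: eventually_mono)
  \<comment> \<open>A negative power of \<open>N\<close> is negligible against every power of
    \<open>ln N\<close>, whatever the exponent.\<close>
  also have "?g \<in> o(\<lambda>N. ln (real N) powr (-3/2 + \<epsilon>))" using c by real_asymp
  finally show ?thesis .
qed

end
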